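(* Let $f:M\to M$ be a partially hyperbolic diffeomorphism of a compact manifold $M$, let $\mu$ be an $f$-invariant probability measure on $M$, and let $\mathcal{E}$ be a compact manifold. Consider cocycles over $f$ on $M\times\mathcal{E}$ admitting stable holonomies, with a topology in which the stable holonomies vary continuously, as described in the context. If $m^k$ are $s$-states for $F_k$ that project to $\mu$, such that $F_k\to F$ and $m^k\to m$ in the weak$^*$ topology, then $m$ is an $s$-state (for $F$).
   Context: **Partial hyperbolicity.** $M$ is a compact $C^\ell$ manifold, $\ell>1$. A diffeomorphism $f:M\to M$ is partially hyperbolic if there are a $Df$-invariant splitting $TM=E^s\oplus E^c\oplus E^u$ with all three sub-bundles of positive dimension, a Riemannian metric $\|\cdot\|$ on $M$, and positive continuous functions $\nu,\hat\nu,\gamma,\hat\gamma$ on $M$ with $\nu,\hat\nu<1$ and $\nu<\gamma<\hat\gamma^{-1}<\hat\nu^{-1}$ such that for every unit vector $v\in T_pM$: $\|Df(p)v\|<\nu(p)$ if $v\in E^s(p)$; $\gamma(p)<\|Df(p)v\|<\hat\gamma(p)^{-1}$ if $v\in E^c(p)$; $\hat\nu(p)^{-1}<\|Df(p)v\|$ if $v\in E^u(p)$. The bundle $E^s$ is uniquely integrable; its integral manifolds form the $f$-invariant strong-stable foliation $\mathcal{W}^s$. Write $x\sim^s y$ if $x$ and $y$ lie in the same leaf of $\mathcal{W}^s$. **Cocycles.** A cocycle over $f$ is a map $F:M\times\mathcal{E}\to M\times\mathcal{E}$ with $P\circ F=f\circ P$, where $P:M\times\mathcal{E}\to M$ is the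 projection to the first coordinate; that is, $F(x,\xi)=(f(x),F_x(\xi))$, and $x\mapsto F_x$ is Hölder continuous with respect to the topology of $C^r$ diffeomorphisms of $\mathcal{E}$. **Stable holonomies.** $F$ admits stable holonomies if for all $x,y\in M$ with $x\sim^s y$ there is a map $H^s_{x,y}:\mathcal{E}\to\mathcal{E}$ such that: (i) $H^s_{x,z}=H^s_{y,z}\circ H^s_{x,y}$ if $x\sim^s y\sim^s z$, and $H^s_{x,x}=\mathrm{id}$; (ii) $F_y\circ H^s_{x,y}=H^s_{f(x),f(y)}\circ F_x$; (iii) $(x,y,\xi)\mapsto H^s_{x,y}(\xi)$ is continuous, where $(x,y)$ varies in the set of pairs with $x\sim^s y$; (iv) there are $C>0$ and $\theta>0$ such that $H^s_{x,y}$ is $(C,\theta)$-Hölder for all $x\sim^s y$. The holonomies of a given cocycle $F$ are denoted $H^{s,F}_{x,y}$. **Topology on cocycles.** $f$ is fixed, and the cocycles $F$ over $f$ vary in a topology such that $(x,y,F)\mapsto H^{s,F}_{x,y}$ varies continuously. **$s$-states.** A probability measure $m$ on $M\times\mathcal{E}$ projects to $\mu$ if $P_*m=\mu$; then $x\mapsto m_x$ denotes its Rokhlin disintegration with respect to the partition into fibers $\{x\}\times\mathcal{E}$, defined for $\mu$-almost every $x$, the $m_x$ being viewed as probability measures on $\mathcal{E}$. An $F$-invariant probability measure $m$ projecting to $\mu$ is an $s$-state for $F$ if there is a full $\mu$-measure set $M'\subset M$ such that $(H^{s,F}_{x,y})_*m_x=m_y$ for all $x,y\in M'$ with $x\sim^s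 y$.
   Formalization: The topology on cocycles is also assumed to make (x,F) ↦ F_x continuous in the uniform topology; otherwise (e.g. an indiscrete topology with H = id) the limit m need not be F-invariant. The fibre manifold E is assumed to have positive dimension. *)

theory Defs
  imports "HOL-Probability.Probability"
begin

section \<open>Differentiability classes between Euclidean spaces\<close>

text \<open>
  All notions below are used on open sets \<open>S\<close> only.  \<open>iter_deriv [v1, ..., vj] f\<close> is the
  iterated directional derivative of \<open>f\<close>, first along \<open>v1\<close>, then along \<open>v2\<close>, and so on.
\<close>

primrec iter_deriv ::
  "'a::euclidean_space list \<Rightarrow> ('a \<Rightarrow> 'b::euclidean_space) \<Rightarrow> 'a \<Rightarrow> 'b" where
  "iter_deriv [] f = f"
| "iter_deriv (v # vs) f = iter_deriv vs (\<lambda>x. frechet_derivative f (at x) v)"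

primrec Ck_on :: "nat \<Rightarrow> ('a::euclidean_space \<Rightarrow> 'b::euclidean_space) \<Rightarrow> 'a set \<Rightarrow> bool" where
  "Ck_on 0 f S \<longleftrightarrow> continuous_on S f"
| "Ck_on (Suc k) f S \<longleftrightarrow>
     (\<forall>x\<in>S. f differentiable (at x)) \<and>
     (\<forall>v\<in>Basis. Ck_on k (\<lambda>x. frechet_derivative f (at x) v) S)"

definition locally_Holder_on ::
  "real \<Rightarrow> ('a::metric_space \<Rightarrow> 'b::metric_space) \<Rightarrow> 'a set \<Rightarrow> bool" where
  "locally_Holder_on \<alpha> f S \<longleftrightarrow>
     (\<forall>x\<in>S. \<exists>e>0. \<exists>C. \<forall>y\<in>ball x e \<inter> S. \<forall>z\<in>ball x e \<inter> S.
        dist (f y) (f z) \<le> C * dist y z powr \<alpha>)"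

text \<open>
  Class \<open>C\<^sup>l\<close> for real \<open>l \<ge> 0\<close>: with \<open>k\<close> the integer part of \<open>l\<close>, the map is \<open>C\<^sup>k\<close> and its
  derivatives of order \<open>k\<close> are locally Hoelder with exponent \<open>l - k\<close>.  For integer \<open>l\<close> the
  second condition is local boundedness, which already follows from the first one.
\<close>

definition Cl_on :: "real \<Rightarrow> ('a::euclidean_space \<Rightarrow> 'b::euclidean_space) \<Rightarrow> 'a set \<Rightarrow> bool" where
  "Cl_on l f S \<longleftrightarrow>
     Ck_on (nat \<lfloor>l\<rfloor>) f S \<and>
     (\<forall>vs\<in>lists Basis. length vs = nat \<lfloor>l\<rfloor> \<longrightarrow>
        locally_Holder_on (l - real (nat \<lfloor>l\<rfloor>)) (iter_deriv vs f) S)"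

section \<open>Compact manifolds\<close>

text \<open>
  A chart is a pair of a domain and a coordinate map.  A manifold is a whole type together with
  an atlas; its dimension is the dimension of the model space \<open>'n\<close>.
\<close>

type_synonym ('a, 'n) chart = "'a set \<times> ('a \<Rightarrow> 'n)"

definition chart_inv :: "('a, 'n) chart \<Rightarrow> 'n \<Rightarrow> 'a" where
  "chart_inv c = inv_into (fst c) (snd c)"

definition is_chart :: "('a::topological_space, 'n::euclidean_space) chart \<Rightarrow> bool" where
  "is_chart c \<longleftrightarrow>
     open (fst c) \<and> open (snd c ` fst c) \<and>
     homeomorphism (fst c) (snd c ` fst c) (snd c) (chart_inv c)"

definition is_atlas ::
  "real \<Rightarrow> ('a::topological_space, 'n::euclidean_space) chart set \<Rightarrow> bool" where
  "is_atlas l A \<longleftrightarrow>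
     (\<forall>c\<in>A. is_chart c) \<and> (\<Union>c\<in>A. fst c) = UNIV \<and>
     (\<forall>c\<in>A. \<forall>d\<in>A. Cl_on l (snd d \<circ> chart_inv c) (snd c ` (fst c \<inter> fst d)))"

text \<open>
  Hoelder conditions on a compact manifold refer to the distance of any Riemannian metric.
  Every such distance is, in charts, locally bi-Lipschitz equivalent to the Euclidean one, and by
  compactness any two distances with this property have the same Hoelder maps.  The type class
  distance \<^term>\<open>dist\<close> is only required to be of this kind.
\<close>

definition compatible_dist :: "('a::metric_space, 'n::euclidean_space) chart set \<Rightarrow> bool" where
  "compatible_dist A \<longleftrightarrow>
     (\<forall>c\<in>A. \<forall>p\<in>fst c. \<exists>e>0. \<exists>L. \<forall>x\<in>ball p e \<inter> fst c. \<forall>y\<in>ball p e \<inter> fst c.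
        dist (snd c x) (snd c y) \<le> L * dist x y \<and>
        dist x y \<le> L * dist (snd c x) (snd c y))"

definition compact_manifold ::
  "real \<Rightarrow> ('a::metric_space, 'n::euclidean_space) chart set \<Rightarrow> bool" where
  "compact_manifold l A \<longleftrightarrow> compact (UNIV :: 'a set) \<and> is_atlas l A \<and> compatible_dist A"

definition Ck_map ::
  "nat \<Rightarrow> ('a::topological_space, 'n::euclidean_space) chart set \<Rightarrow>
   ('b::topological_space, 'k::euclidean_space) chart set \<Rightarrow> ('a \<Rightarrow> 'b) \<Rightarrow> bool" where
  "Ck_map k A B f \<longleftrightarrow>
     continuous_on UNIV f \<and>
     (\<forall>c\<in>A. \<forall>d\<in>B. Ck_on k (snd d \<circ> f \<circ> chart_inv c) (snd c ` (fst c \<inter> f -` fst d)))"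

definition diffeo ::
  "nat \<Rightarrow> ('a::topological_space, 'n::euclidean_space) chart set \<Rightarrow> ('a \<Rightarrow> 'a) \<Rightarrow> bool" where
  "diffeo k A f \<longleftrightarrow> bij f \<and> Ck_map k A A f \<and> Ck_map k A A (inv f)"

section \<open>Tangent vectors\<close>

text \<open>
  Every point \<open>p\<close> has a preferred chart \<open>chart_at A p\<close>, and the tangent space at \<open>p\<close> is the model
  space \<open>'n\<close>, a tangent vector being represented by its coordinates in the preferred chart.
  The preferred chart does not depend continuously on \<open>p\<close>, so continuity in \<open>p\<close> of objects on the
  tangent bundle is always expressed in the frame of a fixed chart \<open>c\<close>: \<open>coord_vec A c p w\<close> is
  the tangent vector at \<open>p\<close> whose coordinates in \<open>c\<close> are \<open>w\<close>.
\<close>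

definition chart_at :: "('a, 'n) chart set \<Rightarrow> 'a \<Rightarrow> ('a, 'n) chart" where
  "chart_at A p = (SOME c. c \<in> A \<and> p \<in> fst c)"

definition coord_vec ::
  "('a, 'n::euclidean_space) chart set \<Rightarrow> ('a, 'n) chart \<Rightarrow> 'a \<Rightarrow> 'n \<Rightarrow> 'n" where
  "coord_vec A c p = frechet_derivative (snd (chart_at A p) \<circ> chart_inv c) (at (snd c p))"

definition tangent_map ::
  "('a, 'n::euclidean_space) chart set \<Rightarrow> ('a \<Rightarrow> 'a) \<Rightarrow> 'a \<Rightarrow> 'n \<Rightarrow> 'n" where
  "tangent_map A f p =
     frechet_derivative (snd (chart_at A (f p)) \<circ> f \<circ> chart_inv (chart_at A p))
       (at (snd (chart_at A p) p))"

definition riemannian_metric ::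
  "('a::topological_space, 'n::euclidean_space) chart set \<Rightarrow> ('a \<Rightarrow> 'n \<Rightarrow> 'n \<Rightarrow> real) \<Rightarrow> bool" where
  "riemannian_metric A g \<longleftrightarrow>
     (\<forall>p. bilinear (g p) \<and> (\<forall>v w. g p v w = g p w v) \<and> (\<forall>v. v \<noteq> 0 \<longrightarrow> 0 < g p v v)) \<and>
     (\<forall>c\<in>A. \<forall>v w. continuous_on (fst c) (\<lambda>p. g p (coord_vec A c p v) (coord_vec A c p w)))"

definition metric_norm :: "('a \<Rightarrow> 'n \<Rightarrow> 'n \<Rightarrow> real) \<Rightarrow> 'a \<Rightarrow> 'n \<Rightarrow> real" where
  "metric_norm g p v = sqrt (g p v v)"

text \<open>The coordinate expression, in the chart \<open>c\<close>, of the fibre at \<open>p\<close> of a sub-bundle \<open>E\<close>.\<close>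

definition in_chart ::
  "('a, 'n::euclidean_space) chart set \<Rightarrow> ('a \<Rightarrow> 'n set) \<Rightarrow> ('a, 'n) chart \<Rightarrow> 'a \<Rightarrow> 'n set" where
  "in_chart A E c p = {w. coord_vec A c p w \<in> E p}"

definition subbundle ::
  "('a::topological_space, 'n::euclidean_space) chart set \<Rightarrow> ('a \<Rightarrow> 'n set) \<Rightarrow> bool" where
  "subbundle A E \<longleftrightarrow>
     (\<forall>p. subspace (E p)) \<and>
     (\<forall>c\<in>A. \<forall>p\<in>fst c. \<exists>U. open U \<and> p \<in> U \<and> U \<subseteq> fst c \<and>
        (\<exists>(d::nat) (X :: nat \<Rightarrow> 'a \<Rightarrow> 'n). (\<forall>i<d. continuous_on U (X i)) \<and>
           (\<forall>q\<in>U. inj_on (\<lambda>i. X i q) {..<d} \<and> independent ((\<lambda>i. X i q) ` {..<d}) \<and>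
                  span ((\<lambda>i. X i q) ` {..<d}) = in_chart A E c q)))"

section \<open>Partial hyperbolicity\<close>

definition partially_hyperbolic ::
  "('m::topological_space, 'n::euclidean_space) chart set \<Rightarrow> ('m \<Rightarrow> 'm) \<Rightarrow>
   ('m \<Rightarrow> 'n set) \<Rightarrow> ('m \<Rightarrow> 'n set) \<Rightarrow> ('m \<Rightarrow> 'n set) \<Rightarrow> bool" where
  "partially_hyperbolic A f Es Ec Eu \<longleftrightarrow>
     diffeo 1 A f \<and>
     (\<forall>E\<in>{Es, Ec, Eu}. subbundle A E \<and>
        (\<forall>p. 0 < dim (E p) \<and> tangent_map A f p ` E p = E (f p))) \<and>
     (\<forall>p v. \<exists>!t. t \<in> Es p \<times> Ec p \<times> Eu p \<and> v = fst t + fst (snd t) + snd (snd t)) \<and>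
     (\<exists>g \<nu> \<nu>h \<gamma> \<gamma>h. riemannian_metric A g \<and>
        (\<forall>\<phi>\<in>{\<nu>, \<nu>h, \<gamma>, \<gamma>h}. continuous_on UNIV \<phi> \<and> (\<forall>p. 0 < \<phi> p)) \<and>
        (\<forall>p. \<nu> p < 1 \<and> \<nu>h p < 1 \<and>
             \<nu> p < \<gamma> p \<and> \<gamma> p < inverse (\<gamma>h p) \<and> inverse (\<gamma>h p) < inverse (\<nu>h p)) \<and>
        (\<forall>p v. metric_norm g p v = 1 \<longrightarrow>
           (v \<in> Es p \<longrightarrow> metric_norm g (f p) (tangent_map A f p v) < \<nu> p) \<and>
           (v \<in> Ec p \<longrightarrow> \<gamma> p < metric_norm g (f p) (tangent_map A f p v) \<and>
                        metric_norm g (f p) (tangent_map A f p v) < inverse (\<gamma>h p)) \<and>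
           (v \<in> Eu p \<longrightarrow> inverse (\<nu>h p) < metric_norm g (f p) (tangent_map A f p v))))"

section \<open>The strong-stable foliation\<close>

definition same_leaf :: "'m set set \<Rightarrow> 'm \<Rightarrow> 'm \<Rightarrow> bool" where
  "same_leaf W x y \<longleftrightarrow> (\<exists>L\<in>W. x \<in> L \<and> y \<in> L)"

text \<open>
  A foliation box \<open>(V, U, h)\<close> maps \<open>U\<close> homeomorphically onto the product of the unit balls of a
  linear subspace \<open>V\<close> and of its orthogonal complement.  Plaques are the preimages of the slices
  parallel to \<open>V\<close>.  Each plaque is a \<open>C\<^sup>1\<close> immersed disc tangent to \<open>E\<close>: the inverse of \<open>h\<close>,
  restricted to a slice and read in a chart \<open>c\<close>, has a continuous injective derivative whose image
  is \<open>E\<close>.  (\<open>D x\<close> is determined by, and is only relevant on, \<open>V\<close>.)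
\<close>

definition plaque :: "'n::euclidean_space set \<times> 'm set \<times> ('m \<Rightarrow> 'n) \<Rightarrow> 'm \<Rightarrow> 'm set" where
  "plaque b x = (case b of (V, U, h) \<Rightarrow> {y\<in>U. x \<in> U \<and> h y - h x \<in> V})"

definition foliation_box ::
  "('m::topological_space, 'n::euclidean_space) chart set \<Rightarrow> ('m \<Rightarrow> 'n set) \<Rightarrow>
   'n set \<times> 'm set \<times> ('m \<Rightarrow> 'n) \<Rightarrow> bool" where
  "foliation_box A E b \<longleftrightarrow> (case b of (V, U, h) \<Rightarrow>
     subspace V \<and> open U \<and>
     homeomorphism U {v + w | v w. v \<in> V \<and> w \<in> V\<^sup>\<bottom> \<and> norm v < 1 \<and> norm w < 1}
       h (inv_into U h) \<and>
     (\<forall>c\<in>A. \<exists>D. \<forall>x\<in>U \<inter> fst c.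
        ((snd c \<circ> inv_into U h) has_derivative D x) (at (h x) within h ` plaque b x) \<and>
        inj_on (D x) V \<and> D x ` V = in_chart A E c x \<and>
        (\<forall>v\<in>V. continuous_on (plaque b x \<inter> fst c) (\<lambda>y. D y v))))"

text \<open>
  A foliation by integral manifolds of \<open>E\<close>: the manifold is covered by foliation boxes whose
  plaques agree locally wherever boxes overlap, and the leaves are the classes of points that can
  be joined by finite chains of plaques.
\<close>

definition integral_foliation ::
  "('m::topological_space, 'n::euclidean_space) chart set \<Rightarrow> ('m \<Rightarrow> 'n set) \<Rightarrow>
   'm set set \<Rightarrow> bool" where
  "integral_foliation A E W \<longleftrightarrow>
     partition_on UNIV W \<and>
     (\<exists>\<B>. (\<forall>b\<in>\<B>. foliation_box A E b) \<and> (\<Union>b\<in>\<B>. fst (snd b)) = UNIV \<and>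
        (\<forall>b\<in>\<B>. \<forall>b'\<in>\<B>. \<forall>x\<in>fst (snd b) \<inter> fst (snd b').
           \<exists>N. open N \<and> x \<in> N \<and> plaque b x \<inter> N = plaque b' x \<inter> N) \<and>
        (\<forall>x y. same_leaf W x y \<longleftrightarrow> (\<lambda>a a'. \<exists>b\<in>\<B>. a' \<in> plaque b a)\<^sup>*\<^sup>* x y))"

text \<open>
  If \<open>Es\<close> is the stable bundle of a partially hyperbolic diffeomorphism, unique integrability of
  \<open>Es\<close> says that there is exactly one such \<open>W\<close>.
\<close>

definition strong_stable_foliation ::
  "('m::topological_space, 'n::euclidean_space) chart set \<Rightarrow> ('m \<Rightarrow> 'm) \<Rightarrow> ('m \<Rightarrow> 'n set) \<Rightarrow>
   'm set set \<Rightarrow> bool" where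
  "strong_stable_foliation A f Es W \<longleftrightarrow> integral_foliation A Es W \<and> (\<forall>L\<in>W. f ` L \<in> W)"

section \<open>Cocycles and stable holonomies\<close>

definition fibre_map :: "('m \<times> 'e \<Rightarrow> 'm \<times> 'e) \<Rightarrow> 'm \<Rightarrow> 'e \<Rightarrow> 'e" where
  "fibre_map F x \<xi> = snd (F (x, \<xi>))"

text \<open>
  Hoelder continuity of \<open>x \<mapsto> G x\<close> in the \<open>C\<^sup>r\<close> topology: in charts, all partial derivatives of
  order at most \<open>r\<close> of \<open>G x\<close> and \<open>G y\<close> differ by at most \<open>C * dist x y powr \<theta>\<close>, locally
  uniformly; by compactness local uniformity is the same as uniformity.
\<close>

definition Holder_Cr ::
  "nat \<Rightarrow> ('e::topological_space, 'k::euclidean_space) chart set \<Rightarrow>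
   ('m::metric_space \<Rightarrow> 'e \<Rightarrow> 'e) \<Rightarrow> bool" where
  "Holder_Cr r B G \<longleftrightarrow>
     (\<exists>\<theta>>0. \<forall>x0 \<xi>0. \<forall>c\<in>B. \<forall>d\<in>B. \<xi>0 \<in> fst c \<and> G x0 \<xi>0 \<in> fst d \<longrightarrow>
        (\<exists>N K C. open N \<and> x0 \<in> N \<and> open K \<and> \<xi>0 \<in> K \<and> K \<subseteq> fst c \<and>
           (\<forall>x\<in>N. G x ` K \<subseteq> fst d) \<and>
           (\<forall>x\<in>N. \<forall>y\<in>N. \<forall>\<xi>\<in>K. \<forall>vs\<in>lists Basis. length vs \<le> r \<longrightarrow>
              dist (iter_deriv vs (snd d \<circ> G x \<circ> chart_inv c) (snd c \<xi>))
                   (iter_deriv vs (snd d \<circ> G y \<circ> chart_inv c) (snd c \<xi>))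
                \<le> C * dist x y powr \<theta>)))"

definition cocycle ::
  "nat \<Rightarrow> ('e::topological_space, 'k::euclidean_space) chart set \<Rightarrow>
   ('m::metric_space \<Rightarrow> 'm) \<Rightarrow> ('m \<times> 'e \<Rightarrow> 'm \<times> 'e) \<Rightarrow> bool" where
  "cocycle r B f F \<longleftrightarrow>
     fst \<circ> F = f \<circ> fst \<and> (\<forall>x. diffeo r B (fibre_map F x)) \<and> Holder_Cr r B (fibre_map F)"

definition stable_holonomies ::
  "'m::topological_space set set \<Rightarrow> ('m \<Rightarrow> 'm) \<Rightarrow> ('m \<times> 'e::metric_space \<Rightarrow> 'm \<times> 'e) \<Rightarrow>
   ('m \<Rightarrow> 'm \<Rightarrow> 'e \<Rightarrow> 'e) \<Rightarrow> bool" where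
  "stable_holonomies W f F H \<longleftrightarrow>
     (\<forall>x y z. same_leaf W x y \<and> same_leaf W y z \<longrightarrow> H x z = H y z \<circ> H x y) \<and>
     (\<forall>x. H x x = id) \<and>
     (\<forall>x y. same_leaf W x y \<longrightarrow>
        fibre_map F y \<circ> H x y = H (f x) (f y) \<circ> fibre_map F x) \<and>
     continuous_on {(x, y, \<xi>). same_leaf W x y} (\<lambda>(x, y, \<xi>). H x y \<xi>) \<and>
     (\<exists>C>0. \<exists>\<theta>>0. \<forall>x y. same_leaf W x y \<longrightarrow>
        (\<forall>\<xi> \<eta>. dist (H x y \<xi>) (H x y \<eta>) \<le> C * dist \<xi> \<eta> powr \<theta>))"

section \<open>Invariant measures and s-states\<close>

definition borel_probability :: "'a::topological_space measure \<Rightarrow> bool" where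
  "borel_probability m \<longleftrightarrow> sets m = sets borel \<and> prob_space m"

definition invariant_measure ::
  "('a::topological_space \<Rightarrow> 'a) \<Rightarrow> 'a measure \<Rightarrow> bool" where
  "invariant_measure f m \<longleftrightarrow> f \<in> borel_measurable borel \<and> distr m borel f = m"

definition projects_to ::
  "('m::topological_space \<times> 'e::topological_space) measure \<Rightarrow> 'm measure \<Rightarrow> bool" where
  "projects_to m \<mu> \<longleftrightarrow> distr m borel fst = \<mu>"

text \<open>
  The Rokhlin disintegration is unique up to a \<open>\<mu>\<close>-null set; a representative is taken to be
  defined on all of the base.
\<close>

definition disintegration ::
  "'m::topological_space measure \<Rightarrow> ('m \<times> 'e::topological_space) measure \<Rightarrow>
   ('m \<Rightarrow> 'e measure) \<Rightarrow> bool" where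
  "disintegration \<mu> m \<kappa> \<longleftrightarrow>
     \<kappa> \<in> measurable borel (prob_algebra borel) \<and>
     (\<forall>S\<in>sets borel. emeasure m S = (\<integral>\<^sup>+ x. emeasure (\<kappa> x) (Pair x -` S) \<partial>\<mu>))"

definition s_state ::
  "'m::topological_space set set \<Rightarrow> 'm measure \<Rightarrow>
   ('m \<times> 'e::topological_space \<Rightarrow> 'm \<times> 'e) \<Rightarrow> ('m \<Rightarrow> 'm \<Rightarrow> 'e \<Rightarrow> 'e) \<Rightarrow>
   ('m \<times> 'e) measure \<Rightarrow> bool" where
  "s_state W \<mu> F H m \<longleftrightarrow>
     borel_probability m \<and> invariant_measure F m \<and> projects_to m \<mu> \<and>
     (\<exists>\<kappa>. disintegration \<mu> m \<kappa> \<and>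
        (\<exists>M'\<in>sets borel. emeasure \<mu> M' = 1 \<and>
           (\<forall>x\<in>M'. \<forall>y\<in>M'. same_leaf W x y \<longrightarrow> distr (\<kappa> x) borel (H x y) = \<kappa> y)))"

definition weak_star_tendsto ::
  "(nat \<Rightarrow> 'a::topological_space measure) \<Rightarrow> 'a measure \<Rightarrow> bool" where
  "weak_star_tendsto ms m \<longleftrightarrow>
     (\<forall>\<phi>::'a \<Rightarrow> real. continuous_on UNIV \<phi> \<and> bounded (range \<phi>) \<longrightarrow>
        (\<lambda>k. integral\<^sup>L (ms k) \<phi>) \<longlonglongrightarrow> integral\<^sup>L m \<phi>)"

section \<open>Topologies on spaces of cocycles\<close>

text \<open>
  \<open>T\<close> is a topology on a set of cocycles over \<open>f\<close>, with \<open>Hol F\<close> the stable holonomies of \<open>F\<close>.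
  The map \<open>(x, y, F) \<mapsto> Hol F x y\<close> is required to be continuous into the continuous self-maps of
  the fibre with the supremum distance.  Moreover \<open>T\<close> is a topology on fibre maps at least as fine
  as the uniform one; without this, limits of \<open>F\<close>-invariant measures need not be invariant.
\<close>

definition cocycle_topology ::
  "nat \<Rightarrow> ('e::metric_space, 'k::euclidean_space) chart set \<Rightarrow> ('m::metric_space \<Rightarrow> 'm) \<Rightarrow>
   'm set set \<Rightarrow> ('m \<times> 'e \<Rightarrow> 'm \<times> 'e) topology \<Rightarrow>
   (('m \<times> 'e \<Rightarrow> 'm \<times> 'e) \<Rightarrow> 'm \<Rightarrow> 'm \<Rightarrow> 'e \<Rightarrow> 'e) \<Rightarrow> bool" where
  "cocycle_topology r B f W T Hol \<longleftrightarrow>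
     (\<forall>F\<in>topspace T. cocycle r B f F \<and> stable_holonomies W f F (Hol F)) \<and>
     continuous_map (prod_topology euclidean T) euclidean (\<lambda>(x, F). Bcontfun (fibre_map F x)) \<and>
     continuous_map
       (subtopology (prod_topology euclidean (prod_topology euclidean T))
          {(x, y, F). same_leaf W x y})
       euclidean (\<lambda>(x, y, F). Bcontfun (Hol F x y))"

end

theory Submission
  imports Defs
begin

text \<open>
  Let \<open>\<kappa>\<^sub>k\<close> and \<open>\<kappa>\<close> be the disintegrations of \<open>m\<^sup>k\<close> and \<open>m\<close>.  Since all these measures have the same
  marginal \<open>\<mu>\<close>, the convergence \<open>m\<^sup>k \<rightarrow> m\<close> says that, for every continuous \<open>\<phi>\<close> on the fibre, the functions
  \<open>x \<mapsto> \<integral> \<phi> d\<kappa>\<^sub>k(x)\<close> converge weakly in \<open>L\<^sup>2(\<mu>)\<close> to \<open>x \<mapsto> \<integral> \<phi> d\<kappa>(x)\<close>.  By a Banach-Saks argument, applied to a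
  countable dense set of functions \<open>\<phi>\<close> at once, suitable Cesaro averages of a subsequence of \<open>\<kappa>\<^sub>k(x)\<close>
  converge to \<open>\<kappa>(x)\<close> for almost every \<open>x\<close>.  For two such points in the same leaf the holonomy of \<open>F\<^sub>k\<close>
  sends \<open>\<kappa>\<^sub>k(x)\<close> to \<open>\<kappa>\<^sub>k(y)\<close> and tends uniformly to that of \<open>F\<close>, so the invariance passes to the averages
  in the limit.

  The disintegration of \<open>m\<close> itself comes from conditional distribution functions, after coding the fibre
  measurably into the real line.
\<close>

section \<open>Continuous functions and finite measures on metric spaces\<close>

text \<open>The obstacle is that weak* convergence controls only integrals over the base: the
  kernels \<open>\<kappa>s k x\<close> can oscillate in \<open>k\<close> at every \<open>x\<close>
  although they converge weakly to \<open>\<kappa>\<close>. The holonomy relation couples two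
  individual points of a leaf and is invisible to such integrals, so convergence at points is
  required. Averages are affordable because pushing forward by one fixed map is linear in the
  measure. For fixed \<open>x\<close> and \<open>y\<close>, exchanging the holonomy of
  \<open>F_k\<close> for that of \<open>F\<close> costs an error tending to zero, and its averages
  then tend to zero too. The indices that are averaged must not depend on the point, since the same
  average is taken at both ends of the holonomy; and the exceptional null set must serve all test
  functions at once, which is where separability of the continuous functions on the fibre enters.
  Averages over \<open>n\<^sup>2\<close> terms are enough, because a limit along any common sequence
  identifies \<open>\<kappa>\<close>. Invariance of \<open>m\<close> under \<open>F\<close> is a
  separate matter and rests on the uniform convergence of \<open>F_k\<close> to
  \<open>F\<close>.\<close>

lemma dense_sequence:
  obtains d :: "nat \<Rightarrow> 'a::{metric_space, second_countable_topology}"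
  where "\<And>x e. 0 < e \<Longrightarrow> \<exists>i. dist x (d i) < e"
proof -
  obtain D :: "'a set" where D: "countable D" "\<And>X. open X \<Longrightarrow> X \<noteq> {} \<Longrightarrow> \<exists>d\<in>D. d \<in> X"
    using countable_dense_setE by metis
  have "\<exists>i. dist x (from_nat_into D i) < e" if "0 < e" for x e
  proof -
    have "\<exists>y\<in>D. y \<in> ball x e"
      using that by (intro D(2)) auto
    then obtain y where "y \<in> D" "dist x y < e"
      by auto
    then show ?thesis
      using from_nat_into_surj[OF D(1)] by metis
  qed
  then show ?thesis by (rule that)
qed

lemma closed_indicator_approx:
  fixes C :: "'a::metric_space set"
  assumes "closed C"
  obtains h :: "nat \<Rightarrow> 'a \<Rightarrow> real"
  where "\<And>n. continuous_on UNIV (h n)" "\<And>n x. 0 \<le> h n x" "\<And>n x. h n x \<le> 1"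
    "\<And>x. (\<lambda>n. h n x) \<longlonglongrightarrow> indicator C x"
proof (cases "C = {}")
  \<comment> \<open>By convention \<open>infdist x {}\<close> is 0, so the formula used for nonempty
    \<open>C\<close> would give the constant 1 here.\<close>
  case True
  then show ?thesis
    using that[of "\<lambda>_ _. 0"] by simp
next
  case False
  define h where "h n x = max 0 (1 - real n * infdist x C)" for n x
  have "(\<lambda>n. h n x) \<longlonglongrightarrow> indicator C x" for x
  proof (cases "x \<in> C")
    case True
    then show ?thesis by (simp add: h_def)
  next
    case x: False
    then have pos: "infdist x C > 0"
      using assms False infdist_pos_not_in_closed by blast
    obtain N :: nat where N: "1 / infdist x C < N"
      using reals_Archimedean2 by blast
    have "h n x = 0" if "n \<ge> N" for n
    proof -
      have "1 / infdist x C \<le> real n"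
        using N that by linarith
      then show ?thesis
        using pos by (simp add: h_def field_simps)
    qed
    then have "\<forall>\<^sub>F n in sequentially. h n x = 0"
      by (auto simp: eventually_sequentially)
    then show ?thesis
      using x by (simp add: tendsto_eventually)
  qed
  moreover have "continuous_on UNIV (h n)" for n
    unfolding h_def by (intro continuous_intros)
  moreover have "0 \<le> h n x" "h n x \<le> 1" for n x
    using infdist_nonneg[of x C] by (auto simp: h_def)
  ultimately show ?thesis
    using that[of h] by simp
qed

text \<open>Indicators of closed sets are bounded pointwise limits of continuous functions, and the
  closed sets are an intersection-stable generator of the Borel sets.\<close>

lemma finite_measure_eqI_continuous:
  fixes M N :: "'a::metric_space measure"
  assumes "finite_measure M" "finite_measure N"
    and [measurable_cong]: "sets M = sets borel" "sets N = sets borel"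
    and eq: "\<And>\<phi>::'a \<Rightarrow> real. continuous_on UNIV \<phi> \<Longrightarrow> bounded (range \<phi>) \<Longrightarrow>
      integral\<^sup>L M \<phi> = integral\<^sup>L N \<phi>"
  shows "M = N"
proof -
  interpret M: finite_measure M by fact
  interpret N: finite_measure N by fact
  have sp: "space M = UNIV" "space N = UNIV"
    using sets_eq_imp_space_eq[OF assms(3)] sets_eq_imp_space_eq[OF assms(4)] by auto
  have closed_eq: "emeasure M C = emeasure N C" if C: "closed C" for C
  proof -
    obtain h :: "nat \<Rightarrow> 'a \<Rightarrow> real" where h: "\<And>n. continuous_on UNIV (h n)"
      "\<And>n x. 0 \<le> h n x" "\<And>n x. h n x \<le> 1" "\<And>x. (\<lambda>n. h n x) \<longlonglongrightarrow> indicator C x"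
      using closed_indicator_approx[OF C] by metis
    have [measurable]: "h n \<in> borel_measurable borel" for n
      using h(1) by (rule borel_measurable_continuous_onI)
    have [measurable]: "C \<in> sets borel" using that by auto
    have "(\<lambda>n. \<integral>x. h n x \<partial>M) \<longlonglongrightarrow> (\<integral>x. indicator C x \<partial>M)"
      by (rule integral_dominated_convergence[where w="\<lambda>_. 1"]) (use h in auto)
    moreover have "(\<lambda>n. \<integral>x. h n x \<partial>N) \<longlonglongrightarrow> (\<integral>x. indicator C x \<partial>N)"
      by (rule integral_dominated_convergence[where w="\<lambda>_. 1"]) (use h in auto)
    moreover have "(\<integral>x. h n x \<partial>M) = (\<integral>x. h n x \<partial>N)" for n
      using h by (intro eq boundedI[of _ 1]) auto
    ultimately have "(\<integral>x. indicator C x \<partial>M) = (\<integral>x. indicator C x \<partial>N :: real)"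
      using LIMSEQ_unique by simp
    then show ?thesis
      by (simp add: sp M.emeasure_eq_measure N.emeasure_eq_measure)
  qed
  show ?thesis
  proof (rule measure_eqI_generator_eq[where \<Omega>=UNIV and E="Collect closed" and A="\<lambda>_. UNIV"])
    show "Int_stable (Collect closed :: 'a set set)"
      by (auto simp: Int_stable_def)
    have "sets (borel :: 'a measure) = sigma_sets UNIV (Collect closed)"
      by (simp add: borel_eq_closed)
    then show "sets M = sigma_sets UNIV (Collect closed)" "sets N = sigma_sets UNIV (Collect closed)"
      using assms by auto
  qed (use closed_eq in auto)
qed

text \<open>A monotone class argument. The approximable functions \<open>D\<close> are stable under
  linear combinations and dominated limits and contain indicators of closed sets; Dynkin induction
  extends this to Borel sets, and induction on integrable functions to all of
  \<open>L\<^sup>1\<close>.\<close>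

lemma continuous_dense_L1:
  fixes M :: "'a::metric_space measure" and f :: "'a \<Rightarrow> real"
  assumes "finite_measure M" and [measurable_cong]: "sets M = sets borel"
    and "integrable M f" and "0 < e"
  obtains c where "continuous_on UNIV c" "bounded (range c)" "(\<integral>x. \<bar>f x - c x\<bar> \<partial>M) < e"
proof -
  interpret M: finite_measure M by fact
  have sp: "space M = UNIV"
    using sets_eq_imp_space_eq[OF assms(2)] by auto
  define C where "C c \<longleftrightarrow> continuous_on UNIV c \<and> bounded (range c)" for c :: "'a \<Rightarrow> real"
  have C_int: "integrable M c" if "C c" for c
  proof -
    obtain b where b: "\<And>x. \<bar>c x\<bar> \<le> b"
      using \<open>C c\<close> by (auto simp: C_def bounded_iff)
    have [measurable]: "c \<in> borel_measurable borel"
      using that by (auto simp: C_def intro: borel_measurable_continuous_onI)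
    show ?thesis
      by (rule M.integrable_const_bound[where B=b]) (use b in auto)
  qed
  define D where "D f \<longleftrightarrow> (\<forall>e>0. \<exists>c. C c \<and> (\<integral>x. \<bar>f x - c x\<bar> \<partial>M) < e)" for f :: "'a \<Rightarrow> real"
  have D_D: "\<exists>c. C c \<and> (\<integral>x. \<bar>f x - c x\<bar> \<partial>M) < e" if "D f" "0 < e" for f e
    using that unfolding D_def by blast
  have D_C: "D c" if "C c" for c
    using that by (auto simp: D_def intro!: exI[of _ c])
  have D_add: "D (\<lambda>x. g x + h x)" if gh: "D g" "D h" "integrable M g" "integrable M h" for g h
    unfolding D_def
  proof safe
    fix e :: real assume "0 < e"
    then have "0 < e / 2" by simp
    then obtain c d where cd: "C c" "(\<integral>x. \<bar>g x - c x\<bar> \<partial>M) < e/2" "C d" "(\<integral>x. \<bar>h x - d x\<bar> \<partial>M) < e/2"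
      using D_D[OF gh(1)] D_D[OF gh(2)] by blast
    have "(\<integral>x. \<bar>(g x + h x) - (c x + d x)\<bar> \<partial>M) \<le> (\<integral>x. \<bar>g x - c x\<bar> + \<bar>h x - d x\<bar> \<partial>M)"
      using that C_int[OF cd(1)] C_int[OF cd(3)] by (intro integral_mono) auto
    also have "\<dots> < e"
      using that C_int[OF cd(1)] C_int[OF cd(3)] cd by (subst Bochner_Integration.integral_add) auto
    finally show "\<exists>c. C c \<and> (\<integral>x. \<bar>g x + h x - c x\<bar> \<partial>M) < e"
      using cd(1,3) by (intro exI[of _ "\<lambda>x. c x + d x"])
        (auto simp: C_def intro!: continuous_on_add bounded_plus_comp)
  qed
  have D_scale: "D (\<lambda>x. a * g x)" if g: "D g" "integrable M g" for a g
    unfolding D_def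
  proof safe
    fix e :: real assume "0 < e"
    \<comment> \<open>The summand 1 covers the case \<open>a = 0\<close>.\<close>
    then have "0 < e / (\<bar>a\<bar> + 1)" by simp
    then obtain c where c: "C c" "(\<integral>x. \<bar>g x - c x\<bar> \<partial>M) < e / (\<bar>a\<bar> + 1)"
      using D_D[OF g(1)] by blast
    have "(\<integral>x. \<bar>a * g x - a * c x\<bar> \<partial>M) = \<bar>a\<bar> * (\<integral>x. \<bar>g x - c x\<bar> \<partial>M)"
      by (simp add: right_diff_distrib[symmetric] abs_mult)
    also have "\<dots> \<le> (\<bar>a\<bar> + 1) * (\<integral>x. \<bar>g x - c x\<bar> \<partial>M)"
      by (intro mult_right_mono) auto
    also have "\<dots> < e"
      using c(2) by (simp add: field_simps)
    finally have "(\<integral>x. \<bar>a * g x - a * c x\<bar> \<partial>M) < e" .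
    moreover have "C (\<lambda>x. a * c x)"
    proof -
      obtain b where "\<And>x. \<bar>c x\<bar> \<le> b"
        using c(1) by (auto simp: C_def bounded_iff)
      then have "norm (a * c x) \<le> \<bar>a\<bar> * b" for x
        by (simp add: abs_mult mult_left_mono)
      then show ?thesis
        using c(1) unfolding C_def by (auto intro!: continuous_intros boundedI)
    qed
    ultimately show "\<exists>c. C c \<and> (\<integral>x. \<bar>a * g x - c x\<bar> \<partial>M) < e"
      by blast
  qed
  \<comment> \<open>This closure property is used three times: for closed sets, for countable
    disjoint unions, and for the passage from simple to integrable functions.\<close>
  have D_lim: "D g" if D: "\<And>i. D (s i)" and int: "\<And>i. integrable M (s i)" "integrable M w" "integrable M g"
    and lim: "\<And>x. (\<lambda>i. s i x) \<longlonglongrightarrow> g x" and le: "\<And>i x. \<bar>s i x\<bar> \<le> w x" for s :: "nat \<Rightarrow> 'a \<Rightarrow> real" and w g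
    unfolding D_def
  proof safe
    fix e :: real assume "0 < e"
    have [measurable]: "g \<in> borel_measurable M" "s i \<in> borel_measurable M" for i
      using int by auto
    have "(\<lambda>i. \<integral>x. \<bar>g x - s i x\<bar> \<partial>M) \<longlonglongrightarrow> (\<integral>x. 0 \<partial>M)"
    proof (rule integral_dominated_convergence[where w="\<lambda>x. \<bar>g x\<bar> + w x"])
      show "AE x in M. (\<lambda>i. \<bar>g x - s i x\<bar>) \<longlonglongrightarrow> 0"
      proof (rule AE_I2)
        fix x show "(\<lambda>i. \<bar>g x - s i x\<bar>) \<longlonglongrightarrow> 0"
          using tendsto_rabs[OF tendsto_diff[OF tendsto_const[of "g x"] lim[of x]]] by simp
      qed
      show "AE x in M. norm \<bar>g x - s i x\<bar> \<le> \<bar>g x\<bar> + w x" for i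
      proof (rule AE_I2)
        fix x show "norm \<bar>g x - s i x\<bar> \<le> \<bar>g x\<bar> + w x"
          using le[of i x] by auto
      qed
    qed (use int in auto)
    then have "\<forall>\<^sub>F i in sequentially. (\<integral>x. \<bar>g x - s i x\<bar> \<partial>M) < e / 2"
      using \<open>0 < e\<close> by (intro order_tendstoD) auto
    then obtain i where i: "(\<integral>x. \<bar>g x - s i x\<bar> \<partial>M) < e / 2"
      by (auto simp: eventually_sequentially)
    have "0 < e / 2" using \<open>0 < e\<close> by simp
    then obtain c where c: "C c" "(\<integral>x. \<bar>s i x - c x\<bar> \<partial>M) < e/2"
      using D_D[OF D] by blast
    have "(\<integral>x. \<bar>g x - c x\<bar> \<partial>M) \<le> (\<integral>x. \<bar>g x - s i x\<bar> + \<bar>s i x - c x\<bar> \<partial>M)"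
      using int C_int[OF c(1)] by (intro integral_mono) auto
    also have "\<dots> < e"
      using int C_int[OF c(1)] c i by (subst Bochner_Integration.integral_add) auto
    finally show "\<exists>c. C c \<and> (\<integral>x. \<bar>g x - c x\<bar> \<partial>M) < e"
      using c by blast
  qed
  have const1: "C (\<lambda>_. 1)"
    by (simp add: C_def)
  have ind_int: "integrable M (indicator A :: 'a \<Rightarrow> real)" if [measurable]: "A \<in> sets borel" for A
    by (rule M.integrable_const_bound[where B=1]) auto
  have D_ind: "D (indicator A)" if "A \<in> sets borel" for A
  proof -
    have "Int_stable (Collect closed :: 'a set set)" "Collect closed \<subseteq> Pow (UNIV :: 'a set)"
      by (auto simp: Int_stable_def)
    moreover have "A \<in> sigma_sets UNIV (Collect closed)"
      using that by (simp add: borel_eq_closed)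
    ultimately show ?thesis
    proof (induction rule: sigma_sets_induct_disjoint)
      case (basic A)
      then have "closed A" by simp
      then obtain h :: "nat \<Rightarrow> 'a \<Rightarrow> real" where h: "\<And>n. continuous_on UNIV (h n)"
        "\<And>n x. 0 \<le> h n x" "\<And>n x. h n x \<le> 1" "\<And>x. (\<lambda>n. h n x) \<longlonglongrightarrow> indicator A x"
        using closed_indicator_approx by metis
      have hC: "C (h n)" for n
        using h unfolding C_def by (auto intro!: boundedI[of _ 1])
      show ?case
      proof (rule D_lim[where s=h and w="\<lambda>_. 1"])
        show "integrable M (indicator A :: 'a \<Rightarrow> real)"
          using \<open>closed A\<close> by (intro ind_int) auto
      qed (use h hC D_C C_int in auto)
    next
      case empty
      then show ?case
        using D_C[of "\<lambda>_. 0"] by (simp add: C_def)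
    next
      case (compl A)
      have A[measurable]: "A \<in> sets borel"
        using compl by (simp add: borel_eq_closed)
      have "D (\<lambda>x. 1 + (-1) * indicator A x)"
        by (rule D_add[OF D_C[OF const1] D_scale[OF compl.IH]]) (use ind_int[OF A] in auto)
      also have "(\<lambda>x. 1 + (-1) * indicator A x :: real) = indicator (UNIV - A)"
        by (auto simp: fun_eq_iff split: split_indicator)
      finally show ?case .
    next
      case (union A)
      have A[measurable]: "A i \<in> sets borel" for i
        using union by (auto simp: borel_eq_closed)
      have sum: "(\<Sum>i<n. indicator (A i) x :: real) = indicator (\<Union>i<n. A i) x" for n x
        using union(1) by (subst indicator_UN_disjoint)
          (auto intro: disjoint_family_on_mono)
      have Ds: "D (\<lambda>x. \<Sum>i<n. indicator (A i) x)" for n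
      proof (induction n)
        case 0
        then show ?case using D_C[of "\<lambda>_. 0"] by (simp add: C_def)
      next
        case (Suc n)
        show ?case
          unfolding sum.lessThan_Suc
          by (rule D_add) (use Suc union ind_int[OF A] in auto)
      qed
      show ?case
      proof (rule D_lim[where s="\<lambda>n. indicator (\<Union>i<n. A i)" and w="\<lambda>_. 1"])
        show "D (indicator (\<Union>i<n. A i))" for n
          using Ds[of n] by (simp add: sum)
        show "(\<lambda>n. indicator (\<Union>i<n. A i) x :: real) \<longlonglongrightarrow> indicator (\<Union>i. A i) x" for x
          by (rule LIMSEQ_indicator_UN)
      qed (use ind_int A in \<open>auto split: split_indicator\<close>)
    qed
  qed
  from \<open>integrable M f\<close> have "D f"
  proof induction
    case (base A c)
    then show ?case
      using D_scale[OF D_ind[of A] ind_int[of A], of c] by (simp add: assms(2) mult.commute)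
  next
    case (add f g)
    then show ?case using D_add by blast
  next
    case (lim f s)
    \<comment> \<open>The approximating sequence supplied by the induction on integrable functions
      is bounded by \<open>2 * \<bar>f x\<bar>\<close>, which therefore dominates.\<close>
    show ?case
    proof (rule D_lim[where s=s and w="\<lambda>x. 2 * \<bar>f x\<bar>"])
      show "integrable M (\<lambda>x. 2 * \<bar>f x\<bar>)"
        using lim(4) by simp
      show "(\<lambda>i. s i x) \<longlonglongrightarrow> f x" "\<bar>s i x\<bar> \<le> 2 * \<bar>f x\<bar>" for i x
        using lim(2)[of x] lim(3)[of x] by (simp_all add: sp)
    qed (fact lim)+
  qed
  then obtain c where "C c" "(\<integral>x. \<bar>f x - c x\<bar> \<partial>M) < e"
    using D_D \<open>0 < e\<close> by blast
  then show ?thesis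
    using that[of c] by (simp add: C_def)
qed

section \<open>Separability of the continuous functions on a compact space\<close>

text \<open>The family is explicit: a finite list of centre indices with rational heights, a
  rational cap \<open>M\<close> and a natural slope \<open>L\<close>. These parameters form a
  countable type, which \<open>from_nat\<close> enumerates.\<close>

lemma separable_continuous_functions:
  assumes "compact (UNIV :: 'e set)"
  obtains \<phi> :: "nat \<Rightarrow> 'e::{metric_space, second_countable_topology} \<Rightarrow> real"
  where "\<And>j. continuous_on UNIV (\<phi> j)"
    "\<And>\<psi> e. continuous_on UNIV \<psi> \<Longrightarrow> 0 < e \<Longrightarrow> \<exists>j. \<forall>\<xi>. \<bar>\<psi> \<xi> - \<phi> j \<xi>\<bar> < e"
proof -
  obtain d :: "nat \<Rightarrow> 'e" where dense: "\<And>\<xi> e. 0 < e \<Longrightarrow> \<exists>i. dist \<xi> (d i) < e"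
    by (rule dense_sequence) blast
  \<comment> \<open>Finite minima of cones, as in the inf-convolution of a continuous function with \<open>L * dist\<close>.\<close>
  define \<Phi> :: "(nat \<times> rat) list \<Rightarrow> rat \<Rightarrow> nat \<Rightarrow> 'e \<Rightarrow> real"
    where "\<Phi> xs M L \<xi> = foldr (\<lambda>p a. min (of_rat (snd p) + real L * dist \<xi> (d (fst p))) a) xs (of_rat M)"
    for xs M L \<xi>
  have \<Phi>_cont: "continuous_on UNIV (\<Phi> xs M L)" for xs M L
    unfolding \<Phi>_def by (induction xs) (auto intro!: continuous_intros)
  have \<Phi>_le: "\<Phi> xs M L \<xi> \<le> of_rat q + real L * dist \<xi> (d i)" if "(i, q) \<in> set xs" for xs M L \<xi> i q
    using that unfolding \<Phi>_def by (induction xs) auto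
  have \<Phi>_ge: "c \<le> \<Phi> xs M L \<xi>"
    if "c \<le> of_rat M" "\<And>i q. (i, q) \<in> set xs \<Longrightarrow> c \<le> of_rat q + real L * dist \<xi> (d i)" for c xs M L \<xi>
    using that unfolding \<Phi>_def by (induction xs) force+
  define \<phi> where "\<phi> j = (case from_nat j of (xs, M, L) \<Rightarrow> \<Phi> xs M L)" for j
  have "continuous_on UNIV (\<phi> j)" for j
    unfolding \<phi>_def by (simp add: \<Phi>_cont split: prod.split)
  moreover have "\<exists>j. \<forall>\<xi>. \<bar>\<psi> \<xi> - \<phi> j \<xi>\<bar> < e" if \<psi>: "continuous_on UNIV \<psi>" and "0 < e" for \<psi> e
  proof -
    \<comment> \<open>Three errors of size \<open>\<epsilon>\<close> add up in the upper bound: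
      rational height, rise of the cone within the net, and oscillation of \<open>\<psi>\<close>.
      The lower bound loses only two.\<close>
    define \<epsilon> where "\<epsilon> = e / 4"
    have \<epsilon>: "0 < \<epsilon>" using \<open>0 < e\<close> by (simp add: \<epsilon>_def)
    have "bounded (range \<psi>)"
      using compact_continuous_image[OF \<psi> assms] by (rule compact_imp_bounded)
    then obtain b where b: "\<And>\<xi>. \<bar>\<psi> \<xi>\<bar> \<le> b"
      by (auto simp: bounded_iff)
    have "uniformly_continuous_on UNIV \<psi>"
      using \<psi> assms by (rule compact_uniformly_continuous)
    then obtain \<delta> where \<delta>: "0 < \<delta>" "\<And>\<xi> \<eta>. dist \<xi> \<eta> < \<delta> \<Longrightarrow> \<bar>\<psi> \<xi> - \<psi> \<eta>\<bar> < \<epsilon>"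
      using \<epsilon> unfolding uniformly_continuous_on_def dist_real_def by (metis UNIV_I)
    \<comment> \<open>The cap lies above \<open>\<psi>\<close> everywhere, so the starting value of
      the fold does not spoil the lower bound.\<close>
    obtain M :: rat where M: "b < of_rat M"
      using of_rat_dense[of b "b + 1"] by auto
    \<comment> \<open>The slope is so steep that a cone whose centre is at distance at least
      \<open>\<delta>\<close> has risen by \<open>2 * b + \<epsilon>\<close>: the full range of
      \<open>\<psi>\<close> plus the error in the height. Such cones cannot push the minimum below
      \<open>\<psi>\<close>.\<close>
    obtain L :: nat where L: "(2 * b + \<epsilon>) / \<delta> < real L"
      using reals_Archimedean2 by blast
    \<comment> \<open>The net is chosen after the slope: within distance \<open>\<eta>\<close> a
      cone rises by at most \<open>\<epsilon>\<close>, and \<open>\<psi>\<close> varies by less than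
      \<open>\<epsilon>\<close>. Dividing by \<open>real L + 1\<close> covers
      \<open>L = 0\<close>.\<close>
    define \<eta> where "\<eta> = min \<delta> (\<epsilon> / (real L + 1))"
    have \<eta>: "0 < \<eta>" "\<eta> \<le> \<delta>" using \<delta>(1) \<epsilon> by (auto simp: \<eta>_def)
    have L\<eta>: "real L * \<eta> \<le> \<epsilon>"
    proof -
      have "real L * \<eta> \<le> (real L + 1) * (\<epsilon> / (real L + 1))"
        using \<eta>(1) by (intro mult_mono) (auto simp: \<eta>_def)
      then show ?thesis by simp
    qed
    have "UNIV \<subseteq> (\<Union>i\<in>UNIV. ball (d i) \<eta>)"
      using dense[OF \<eta>(1)] by (auto simp: dist_commute)
    then obtain I where I: "finite I" "UNIV \<subseteq> (\<Union>i\<in>I. ball (d i) \<eta>)"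
      using compactE_image[OF assms, of UNIV "\<lambda>i. ball (d i) \<eta>"] by auto
    have "\<exists>q :: rat. \<psi> (d i) - \<epsilon> < of_rat q \<and> of_rat q < \<psi> (d i) + \<epsilon>" for i
      using of_rat_dense[of "\<psi> (d i) - \<epsilon>" "\<psi> (d i) + \<epsilon>"] \<epsilon> by simp
    then obtain q :: "nat \<Rightarrow> rat" where q: "\<And>i. \<psi> (d i) - \<epsilon> < of_rat (q i)" "\<And>i. of_rat (q i) < \<psi> (d i) + \<epsilon>"
      by metis
    define xs where "xs = map (\<lambda>i. (i, q i)) (sorted_list_of_set I)"
    have xs: "set xs = (\<lambda>i. (i, q i)) ` I"
      using I(1) by (simp add: xs_def)
    have "\<bar>\<psi> \<xi> - \<Phi> xs M L \<xi>\<bar> < e" for \<xi>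
    proof -
      obtain i where i: "i \<in> I" "dist (d i) \<xi> < \<eta>"
        using subsetD[OF I(2) UNIV_I[of \<xi>]] by auto
      have "\<Phi> xs M L \<xi> \<le> of_rat (q i) + real L * dist \<xi> (d i)"
        using i(1) by (intro \<Phi>_le) (auto simp: xs)
      also have "\<dots> \<le> (\<psi> (d i) + \<epsilon>) + \<epsilon>"
      proof (intro add_mono order.strict_implies_order[OF q(2)])
        have "real L * dist \<xi> (d i) \<le> real L * \<eta>"
          using i(2) by (intro mult_left_mono) (auto simp: dist_commute)
        then show "real L * dist \<xi> (d i) \<le> \<epsilon>"
          using L\<eta> by linarith
      qed
      also have "\<psi> (d i) < \<psi> \<xi> + \<epsilon>"
        using \<delta>(2)[of "d i" \<xi>] i(2) \<eta>(2) by linarith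
      finally have "\<Phi> xs M L \<xi> < \<psi> \<xi> + e"
        using \<open>0 < e\<close> by (simp add: \<epsilon>_def)
      moreover have "\<psi> \<xi> - 2 * \<epsilon> \<le> \<Phi> xs M L \<xi>"
      proof (rule \<Phi>_ge)
        show "\<psi> \<xi> - 2 * \<epsilon> \<le> of_rat M"
          using b[of \<xi>] M \<epsilon> by linarith
        fix i q' assume "(i, q') \<in> set xs"
        then have [simp]: "q' = q i" by (auto simp: xs)
        show "\<psi> \<xi> - 2 * \<epsilon> \<le> of_rat q' + real L * dist \<xi> (d i)"
        proof (cases "dist \<xi> (d i) < \<delta>")
          case True
          have "0 \<le> real L * dist \<xi> (d i)" by simp
          then show ?thesis
            using \<delta>(2)[OF True] q(1)[of i] unfolding \<open>q' = q i\<close> by linarith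
        next
          case False
          have "2 * b + \<epsilon> \<le> real L * \<delta>"
            using L \<delta>(1) by (simp add: field_simps)
          also have "\<dots> \<le> real L * dist \<xi> (d i)"
            using False by (intro mult_left_mono) auto
          finally show ?thesis
            using q(1)[of i] b[of "d i"] b[of \<xi>] \<epsilon> unfolding \<open>q' = q i\<close> by linarith
        qed
      qed
      ultimately show ?thesis
        using \<epsilon> by (simp add: \<epsilon>_def abs_less_iff)
    qed
    moreover have "\<phi> (to_nat (xs, M, L)) = \<Phi> xs M L"
      by (simp add: \<phi>_def)
    ultimately show ?thesis by metis
  qed
  ultimately show ?thesis by (rule that)
qed

section \<open>Almost everywhere convergence of averages\<close>

text \<open>
  The averages over \<open>n\<close> terms have second moment \<open>O(1/n)\<close>, which is summable along the squares.
\<close>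

lemma Banach_Saks_AE_squares:
  fixes d :: "nat \<Rightarrow> 'a \<Rightarrow> real"
  assumes "prob_space M"
    and [measurable]: "\<And>i. d i \<in> borel_measurable M"
    and bound: "\<And>i x. \<bar>d i x\<bar> \<le> C"
    and corr: "\<And>n. (\<Sum>l<n. \<bar>\<integral>x. d l x * d n x \<partial>M\<bar>) \<le> c"
  shows "AE x in M. (\<lambda>n. (\<Sum>i<n\<^sup>2. d i x) / real (n\<^sup>2)) \<longlonglongrightarrow> 0"
proof -
  interpret prob_space M by fact
  have C0: "0 \<le> C"
    using bound[of 0 undefined] by (metis abs_ge_zero order_trans)
  have int: "integrable M (d i)" for i
    by (rule integrable_const_bound[where B=C]) (use bound in auto)
  have int2: "integrable M (\<lambda>x. d i x * d j x)" for i j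
  proof (rule integrable_const_bound[where B="C * C"])
    show "AE x in M. norm (d i x * d j x) \<le> C * C"
      using bound C0 by (intro AE_I2) (auto simp: abs_mult intro!: mult_mono)
  qed auto
  define S where "S n x = (\<Sum>i<n. d i x)" for n x
  have S_meas[measurable]: "S n \<in> borel_measurable M" for n
    unfolding S_def by measurable
  have S_bound: "\<bar>S n x\<bar> \<le> n * C" for n x
    unfolding S_def using sum_norm_bound[of "{..<n}" "\<lambda>i. d i x" C] bound by simp
  have intS: "integrable M (\<lambda>x. (S n x)\<^sup>2)" for n
  proof (rule integrable_const_bound[where B="(n * C)\<^sup>2"])
    show "AE x in M. norm ((S n x)\<^sup>2) \<le> (n * C)\<^sup>2"
      using S_bound[of n] C0 by (intro AE_I2) (simp add: power2_le_iff_abs_le)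
  qed auto
  \<comment> \<open>Appending \<open>d n\<close> to the sum raises the second moment by twice its
    correlations with the earlier terms, at most \<open>2 * c\<close>, plus its own second moment,
    at most \<open>C * C\<close>.\<close>
  define K where "K = 2 * c + C * C"
  have K0: "0 \<le> K"
    using corr[of 0] by (simp add: K_def)
  have var: "(\<integral>x. (S n x)\<^sup>2 \<partial>M) \<le> n * K" for n
  proof (induction n)
    case 0
    then show ?case by (simp add: S_def)
  next
    case (Suc n)
    have "(\<integral>x. (S (Suc n) x)\<^sup>2 \<partial>M)
        = (\<integral>x. (S n x)\<^sup>2 + (2 * (\<Sum>l<n. d l x * d n x) + d n x * d n x) \<partial>M)"
      by (simp add: S_def power2_eq_square sum_distrib_left sum_distrib_right algebra_simps)
    also have "\<dots> = (\<integral>x. (S n x)\<^sup>2 \<partial>M) +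
        (2 * (\<Sum>l<n. \<integral>x. d l x * d n x \<partial>M) + (\<integral>x. d n x * d n x \<partial>M))"
      using intS int2 by simp
    also have "(\<Sum>l<n. \<integral>x. d l x * d n x \<partial>M) \<le> c"
      using corr[of n] by (meson abs_ge_self order_trans sum_mono)
    also have "(\<integral>x. d n x * d n x \<partial>M) \<le> (\<integral>x. C * C \<partial>M)"
    proof (rule integral_mono)
      show "d n x * d n x \<le> C * C" for x
        using bound[of n x] C0 by (metis abs_ge_zero abs_mult_self_eq mult_mono)
    qed (use int2 in auto)
    finally have "(\<integral>x. (S (Suc n) x)\<^sup>2 \<partial>M) \<le> (\<integral>x. (S n x)\<^sup>2 \<partial>M) + K"
      by (simp add: K_def prob_space)
    then show ?case
      using Suc by (simp add: algebra_simps)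
  qed
  \<comment> \<open>The index \<open>Suc n\<close> avoids division by zero; the shift is undone at
    the end. The integrals of \<open>q n\<close> are bounded by \<open>K / (n + 1)\<^sup>2\<close>,
    hence summable, so \<open>q n x\<close> is summable in \<open>n\<close> for almost every
    \<open>x\<close>.\<close>
  define q where "q n x = (S ((Suc n)\<^sup>2) x / real ((Suc n)\<^sup>2))\<^sup>2" for n x
  have q_meas[measurable]: "q n \<in> borel_measurable M" for n
    unfolding q_def by measurable
  have q_int: "(\<integral>\<^sup>+x. ennreal (q n x) \<partial>M) \<le> ennreal (K * inverse ((real (Suc n))\<^sup>2))" for n
  proof -
    have "(\<integral>x. q n x \<partial>M) = (\<integral>x. (S ((Suc n)\<^sup>2) x)\<^sup>2 \<partial>M) / (real ((Suc n)\<^sup>2))\<^sup>2"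
      by (simp add: q_def power_divide)
    also have "\<dots> \<le> (real ((Suc n)\<^sup>2) * K) / (real ((Suc n)\<^sup>2))\<^sup>2"
      using var[of "(Suc n)\<^sup>2"] by (intro divide_right_mono) auto
    also have "\<dots> = K * inverse (real ((Suc n)\<^sup>2))"
    proof -
      have "a * K / a\<^sup>2 = K * inverse a" if "a \<noteq> 0" for a :: real
        using that by (simp add: power2_eq_square field_simps)
      then show ?thesis by (metis of_nat_eq_0_iff power_eq_0_iff nat.distinct(1))
    qed
    also have "\<dots> = K * inverse ((real (Suc n))\<^sup>2)"
      by simp
    finally have le: "(\<integral>x. q n x \<partial>M) \<le> K * inverse ((real (Suc n))\<^sup>2)" .
    have "integrable M (q n)"
      unfolding q_def power_divide using intS[of "(Suc n)\<^sup>2"] by simp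
    then have "(\<integral>\<^sup>+x. ennreal (q n x) \<partial>M) = ennreal (\<integral>x. q n x \<partial>M)"
      by (rule nn_integral_eq_integral) (simp add: q_def)
    then show ?thesis
      using le by (simp add: ennreal_leI)
  qed
  have summ: "summable (\<lambda>n. K * inverse ((real (Suc n))\<^sup>2))"
    using inverse_power_summable[of 2, where 'a=real]
    by (intro summable_mult) (subst summable_Suc_iff, simp)
  have "(\<integral>\<^sup>+x. (\<Sum>n. ennreal (q n x)) \<partial>M) = (\<Sum>n. \<integral>\<^sup>+x. ennreal (q n x) \<partial>M)"
    by (rule nn_integral_suminf) simp
  also have "\<dots> \<le> (\<Sum>n. ennreal (K * inverse ((real (Suc n))\<^sup>2)))"
    using q_int by (intro suminf_le) auto
  also have "\<dots> = ennreal (\<Sum>n. K * inverse ((real (Suc n))\<^sup>2))"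
    using summ K0 by (intro suminf_ennreal2) auto
  also have "\<dots> < \<infinity>" by simp
  finally have "(\<integral>\<^sup>+x. (\<Sum>n. ennreal (q n x)) \<partial>M) \<noteq> \<infinity>" by simp
  then have "AE x in M. (\<Sum>n. ennreal (q n x)) \<noteq> \<infinity>"
    by (intro nn_integral_PInf_AE) auto
  then show ?thesis
  proof eventually_elim
    case (elim x)
    have "summable (\<lambda>n. q n x)"
      using elim by (intro summable_suminf_not_top) (auto simp: q_def)
    then have "(\<lambda>n. q n x) \<longlonglongrightarrow> 0"
      by (rule summable_LIMSEQ_zero)
    then have "(\<lambda>n. sqrt (q n x)) \<longlonglongrightarrow> sqrt 0"
      by (rule tendsto_real_sqrt)
    then have "(\<lambda>n. \<bar>S ((Suc n)\<^sup>2) x / real ((Suc n)\<^sup>2)\<bar>) \<longlonglongrightarrow> 0"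
      by (simp only: q_def real_sqrt_abs real_sqrt_zero)
    then have "(\<lambda>n. S ((Suc n)\<^sup>2) x / real ((Suc n)\<^sup>2)) \<longlonglongrightarrow> 0"
      by (simp only: tendsto_rabs_zero_iff)
    then show ?case
      using filterlim_sequentially_Suc[of "\<lambda>n. S (n\<^sup>2) x / real (n\<^sup>2)"] by (simp add: S_def)
  qed
qed

text \<open>
  The subsequence is chosen so sparse that each new term is nearly uncorrelated with all earlier
  ones, for the first \<open>n\<close> test indices \<open>j\<close> at the \<open>n\<close>-th step; this serves all \<open>j\<close> simultaneously.
\<close>

lemma decorrelated_subsequence:
  fixes r :: "nat \<Rightarrow> nat \<Rightarrow> nat \<Rightarrow> real"
  assumes lim: "\<And>j l. (\<lambda>k. r j l k) \<longlonglongrightarrow> 0"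
    and bound: "\<And>j l k. \<bar>r j l k\<bar> \<le> C j"
  obtains \<sigma> :: "nat \<Rightarrow> nat" and c :: "nat \<Rightarrow> real"
  where "strict_mono \<sigma>" "\<And>j n. (\<Sum>l<n. \<bar>r j (\<sigma> l) (\<sigma> n)\<bar>) \<le> c j"
proof -
  \<comment> \<open>The threshold is fitted to the number of terms: with
    \<open>K = \<sigma> p \<ge> p\<close>, the \<open>p + 1\<close> correlations of the next term
    are each below \<open>1 / (p + 1)\<close>, so they sum to at most 1.\<close>
  have "\<exists>N. \<forall>k\<ge>N. \<forall>j\<in>{..K}. \<forall>l\<in>{..K}. \<bar>r j l k\<bar> < 1 / (real K + 1)" for K
  proof -
    have "\<forall>\<^sub>F k in sequentially. \<bar>r j l k\<bar> < 1 / (real K + 1)" for j l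
    proof (rule order_tendstoD)
      show "(\<lambda>k. \<bar>r j l k\<bar>) \<longlonglongrightarrow> 0"
        using lim by (simp add: tendsto_rabs_zero)
    qed simp
    then have "\<forall>\<^sub>F k in sequentially. \<forall>j\<in>{..K}. \<forall>l\<in>{..K}. \<bar>r j l k\<bar> < 1 / (real K + 1)"
      by (intro eventually_ball_finite ballI) auto
    then show ?thesis by (simp add: eventually_sequentially)
  qed
  then obtain N where N: "\<And>K k j l. k \<ge> N K \<Longrightarrow> j \<le> K \<Longrightarrow> l \<le> K \<Longrightarrow> \<bar>r j l k\<bar> < 1 / (real K + 1)"
    by (metis atMost_iff)
  define \<sigma> where "\<sigma> = rec_nat 0 (\<lambda>_ s. max (N s) (Suc s))"
  have \<sigma>_Suc: "\<sigma> (Suc n) = max (N (\<sigma> n)) (Suc (\<sigma> n))" for n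
    by (simp add: \<sigma>_def)
  have mono: "strict_mono \<sigma>"
    unfolding strict_mono_Suc_iff by (simp add: \<sigma>_Suc less_max_iff_disj)
  have C0: "0 \<le> C j" for j
    using bound[of j 0 0] by simp
  \<comment> \<open>For \<open>n \<le> j\<close> the test index \<open>j\<close> may not yet be
    under control; the trivial bound on at most \<open>j\<close> terms gives
    \<open>real j * C j\<close>. The 1 accounts for all later \<open>n\<close>.\<close>
  have "(\<Sum>l<n. \<bar>r j (\<sigma> l) (\<sigma> n)\<bar>) \<le> real j * C j + 1" for j n
  proof (cases "n \<le> j")
    case True
    have "(\<Sum>l<n. \<bar>r j (\<sigma> l) (\<sigma> n)\<bar>) \<le> (\<Sum>l<n. C j)"
      by (intro sum_mono bound)
    also have "\<dots> \<le> real j * C j"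
      using True C0[of j] by (simp add: mult_right_mono)
    finally show ?thesis by simp
  next
    case False
    then obtain p where p: "n = Suc p" "j \<le> p"
      by (cases n) auto
    have "\<bar>r j (\<sigma> l) (\<sigma> n)\<bar> \<le> 1 / real n" if "l < n" for l
    proof -
      have "p \<le> \<sigma> p" "\<sigma> l \<le> \<sigma> p"
        using mono p that by (auto simp: strict_mono_imp_increasing strict_mono_less_eq)
      then have "\<bar>r j (\<sigma> l) (\<sigma> n)\<bar> < 1 / (real (\<sigma> p) + 1)"
        using p by (intro N) (auto simp: \<sigma>_Suc)
      also have "\<dots> \<le> 1 / real n"
        using \<open>p \<le> \<sigma> p\<close> p by (intro divide_left_mono) auto
      finally show ?thesis by simp
    qed
    then have "(\<Sum>l<n. \<bar>r j (\<sigma> l) (\<sigma> n)\<bar>) \<le> (\<Sum>l<n. 1 / real n)"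
      by (intro sum_mono) auto
    also have "\<dots> \<le> 1"
      using p by simp
    also have "\<dots> \<le> real j * C j + 1"
      using C0[of j] by simp
    finally show ?thesis .
  qed
  then show ?thesis
    using that[of \<sigma> "\<lambda>j. real j * C j + 1"] mono by blast
qed

text \<open>Used for the error made when the varying holonomies are replaced by the limit one; the
  squares match the averages of \<open>Banach_Saks_AE_squares\<close>.\<close>

lemma Cesaro_squares_null:
  fixes a :: "nat \<Rightarrow> real"
  assumes "a \<longlonglongrightarrow> 0"
  shows "(\<lambda>n. (\<Sum>i<n\<^sup>2. a i) / real (n\<^sup>2)) \<longlonglongrightarrow> 0"
proof -
  have "(\<lambda>n. (\<Sum>i<n. a i) / real n) \<longlonglongrightarrow> 0"
  proof (rule LIMSEQ_I)
    fix e :: real assume "0 < e"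
    then obtain N where N: "\<And>n. n \<ge> N \<Longrightarrow> \<bar>a n\<bar> < e / 2"
      using LIMSEQ_D[OF assms, of "e/2"] by auto
    define B where "B = (\<Sum>i<N. \<bar>a i\<bar>)"
    obtain K :: nat where K: "2 * B / e < K"
      using reals_Archimedean2 by blast
    have "norm ((\<Sum>i<n. a i) / real n - 0) < e" if n: "n \<ge> max (Suc N) K" for n
    proof -
      have "\<bar>\<Sum>i<n. a i\<bar> \<le> (\<Sum>i<n. \<bar>a i\<bar>)" by simp
      also have "\<dots> = B + (\<Sum>i\<in>{N..<n}. \<bar>a i\<bar>)"
        unfolding B_def using n by (subst sum.union_disjoint[symmetric]) (auto simp: ivl_disj_un)
      also have "(\<Sum>i\<in>{N..<n}. \<bar>a i\<bar>) \<le> (\<Sum>i\<in>{N..<n}. e / 2)"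
        using N by (intro sum_mono) (auto intro: less_imp_le)
      also have "\<dots> \<le> real n * (e / 2)"
        using \<open>0 < e\<close> by (simp add: mult_right_mono)
      also have "B < real n * (e / 2)"
      proof -
        have "2 * B / e < real n" using K n by simp
        then show ?thesis using \<open>0 < e\<close> by (simp add: field_simps)
      qed
      finally show ?thesis
        using n by (simp add: field_simps)
    qed
    then show "\<exists>no. \<forall>n\<ge>no. norm ((\<Sum>i<n. a i) / real n - 0) < e" by blast
  qed
  moreover have "filterlim (\<lambda>n::nat. n\<^sup>2) sequentially sequentially"
    by (rule filterlim_subseq) (auto simp: strict_mono_def power_strict_mono)
  ultimately show ?thesis
    by (rule filterlim_compose[where g="\<lambda>n. (\<Sum>i<n. a i) / real n"])
qed

section \<open>Disintegration\<close>

text \<open>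
  Base 3 with digits 0 and 1 only, so that different digit sequences have different codes.
\<close>

definition ternary_code :: "(nat \<Rightarrow> bool) \<Rightarrow> real" where
  "ternary_code b = (\<Sum>n. of_bool (b n) * (1/3) ^ Suc n)"

definition ternary_shift :: "real \<Rightarrow> real" where
  "ternary_shift t = 3 * t - of_bool (1 \<le> 3 * t)"

definition ternary_digit :: "real \<Rightarrow> nat \<Rightarrow> bool" where
  "ternary_digit t n \<longleftrightarrow> 1 \<le> 3 * (ternary_shift ^^ n) t"

lemma summable_ternary: "summable (\<lambda>n. of_bool (b n) * (1/3 :: real) ^ Suc n)"
proof (rule summable_comparison_test)
  show "\<exists>N. \<forall>n\<ge>N. norm (of_bool (b n) * (1/3 :: real) ^ Suc n) \<le> (1/3) ^ n"
    by (intro exI[of _ 0]) (simp add: power_divide divide_left_mono)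
qed (simp add: summable_geometric)

lemma ternary_code_nonneg: "0 \<le> ternary_code b"
  unfolding ternary_code_def by (intro suminf_nonneg summable_ternary) auto

text \<open>This bound is what makes decoding possible: a tail below 1 never carries into the
  leading digit, so comparing \<open>3 * ternary_code b\<close> with 1 reads that digit off.\<close>

lemma ternary_code_le: "ternary_code b \<le> 1 / 2"
proof -
  have "ternary_code b \<le> (\<Sum>n. (1/3) * (1/3) ^ n)"
    unfolding ternary_code_def
    by (intro suminf_le summable_ternary summable_mult summable_geometric) auto
  also have "\<dots> = 1/2"
    by (subst suminf_mult) (simp_all add: summable_geometric suminf_geometric)
  finally show ?thesis .
qed

lemma ternary_code_rec: "3 * ternary_code b = of_bool (b 0) + ternary_code (\<lambda>n. b (Suc n))"
proof -
  have "(\<Sum>n. of_bool (b (Suc n)) * (1/3 :: real) ^ Suc (Suc n)) = ternary_code b - of_bool (b 0) * (1/3)"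
    unfolding ternary_code_def using suminf_split_head[OF summable_ternary[of b]] by simp
  moreover have "(\<Sum>n. of_bool (b (Suc n)) * (1/3 :: real) ^ Suc (Suc n)) = (1/3) * ternary_code (\<lambda>n. b (Suc n))"
    unfolding ternary_code_def
    using suminf_mult[OF summable_ternary[of "\<lambda>n. b (Suc n)"], of "1/3"] by (simp add: mult_ac)
  ultimately show ?thesis by simp
qed

lemma ternary_code_head: "1 \<le> 3 * ternary_code b \<longleftrightarrow> b 0"
  using ternary_code_rec[of b] ternary_code_nonneg[of "\<lambda>n. b (Suc n)"] ternary_code_le[of "\<lambda>n. b (Suc n)"]
  by (cases "b 0") auto

lemma ternary_shift_code: "ternary_shift (ternary_code b) = ternary_code (\<lambda>n. b (Suc n))"
  unfolding ternary_shift_def ternary_code_head using ternary_code_rec[of b] by simp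

lemma ternary_digit_code: "ternary_digit (ternary_code b) n = b n"
proof -
  have "(ternary_shift ^^ n) (ternary_code b) = ternary_code (\<lambda>i. b (i + n))"
    by (induction n) (simp_all add: ternary_shift_code)
  then show ?thesis
    by (simp add: ternary_digit_def ternary_code_head)
qed

lemma measurable_ternary_digit[measurable]: "Measurable.pred borel (\<lambda>t. ternary_digit t n)"
proof -
  have [measurable]: "ternary_shift \<in> borel_measurable borel"
    unfolding ternary_shift_def by measurable
  have [measurable]: "(ternary_shift ^^ n) \<in> borel_measurable borel"
    by (induction n) (auto simp: id_def o_def intro: measurable_compose)
  show ?thesis
    unfolding ternary_digit_def by measurable
qed

text \<open>A point is coded by the answers to the countably many questions
  \<open>dist \<xi> (d i) < 1 / (n + 1)\<close>. The decoder picks, for every \<open>n\<close>, the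
  first centre with answer yes; these centres converge to \<open>\<xi>\<close>.\<close>

lemma compact_metric_real_coding:
  assumes "compact (UNIV :: 'e set)"
  obtains \<iota> :: "'e::{metric_space, second_countable_topology} \<Rightarrow> real" and q :: "real \<Rightarrow> 'e"
  where "\<iota> \<in> borel_measurable borel" "q \<in> borel_measurable borel"
    "\<And>\<xi>. q (\<iota> \<xi>) = \<xi>" "\<And>\<xi>. 0 \<le> \<iota> \<xi>" "\<And>\<xi>. \<iota> \<xi> \<le> 1"
proof -
  obtain d :: "nat \<Rightarrow> 'e" where dense: "\<And>\<xi> e. 0 < e \<Longrightarrow> \<exists>i. dist \<xi> (d i) < e"
    by (rule dense_sequence) blast
  define b where "b \<xi> k = (case prod_decode k of (i, n) \<Rightarrow> dist \<xi> (d i) < 1 / real (Suc n))" for \<xi> k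
  define \<iota> where "\<iota> \<xi> = ternary_code (b \<xi>)" for \<xi>
  define a where "a n t = d (LEAST i. ternary_digit t (prod_encode (i, n)))" for n t
  \<comment> \<open>Outside the range of \<open>\<iota>\<close> the chosen centres may fail to
    converge. The constant \<open>d 0\<close> makes the sequence convergent for every real
    \<open>t\<close> (Cauchy sequences converge by compactness), so \<open>q\<close> is measurable
    as an everywhere defined pointwise limit.\<close>
  define Q where "Q n t = (if Cauchy (\<lambda>n. a n t) then a n t else d 0)" for n t
  define q where "q t = lim (\<lambda>n. Q n t)" for t
  have b_meas[measurable]: "Measurable.pred borel (\<lambda>\<xi>. b \<xi> k)" for k
    unfolding b_def by (cases "prod_decode k") simp
  have \<iota>: "\<iota> \<in> borel_measurable borel"
    unfolding \<iota>_def ternary_code_def by measurable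
  have [measurable]: "a n \<in> borel_measurable borel" for n
    unfolding a_def by (rule measurable_compose[OF measurable_Least]) auto
  have [measurable]: "Q n \<in> borel_measurable borel" for n
    unfolding Q_def by measurable
  have "convergent (\<lambda>n. Q n t)" for t
  proof (cases "Cauchy (\<lambda>n. a n t)")
    case True
    have "convergent (\<lambda>n. a n t)"
      using completeE[OF compact_imp_complete[OF assms] _ True] unfolding convergent_def by blast
    then show ?thesis
      using True by (simp add: Q_def)
  next
    case False
    then show ?thesis
      by (simp add: Q_def convergent_const)
  qed
  then have Q_lim: "(\<lambda>n. Q n t) \<longlonglongrightarrow> q t" for t
    unfolding q_def by (simp add: convergent_LIMSEQ_iff)
  have q: "q \<in> borel_measurable borel"
    by (rule borel_measurable_LIMSEQ_metric[OF _ Q_lim]) simp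
  have "q (\<iota> \<xi>) = \<xi>" for \<xi>
  proof -
    have "dist (a n (\<iota> \<xi>)) \<xi> < 1 / real (Suc n)" for n
    proof -
      have "a n (\<iota> \<xi>) = d (LEAST i. dist \<xi> (d i) < 1 / real (Suc n))"
        by (simp add: a_def \<iota>_def ternary_digit_code b_def)
      moreover have "dist \<xi> (d (LEAST i. dist \<xi> (d i) < 1 / real (Suc n))) < 1 / real (Suc n)"
        by (rule LeastI_ex) (use dense in simp)
      ultimately show ?thesis
        by (simp add: dist_commute)
    qed
    then have "(\<lambda>n. dist (a n (\<iota> \<xi>)) \<xi>) \<longlonglongrightarrow> 0"
      by (intro tendsto_sandwich[OF _ _ tendsto_const LIMSEQ_inverse_real_of_nat])
        (auto simp: inverse_eq_divide intro!: always_eventually less_imp_le)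
    then have lim: "(\<lambda>n. a n (\<iota> \<xi>)) \<longlonglongrightarrow> \<xi>"
      by (subst tendsto_dist_iff)
    then have "(\<lambda>n. Q n (\<iota> \<xi>)) \<longlonglongrightarrow> \<xi>"
      using LIMSEQ_imp_Cauchy[OF lim] by (simp add: Q_def)
    then show ?thesis
      by (rule LIMSEQ_unique[OF Q_lim])
  qed
  moreover have "\<iota> \<xi> \<le> 1" for \<xi>
    using ternary_code_le[of "b \<xi>"] by (simp add: \<iota>_def)
  ultimately show ?thesis
    using that[OF \<iota> q] by (simp add: \<iota>_def ternary_code_nonneg)
qed

section \<open>Disintegration with real fibres\<close>

text \<open>It suffices to test on the set where \<open>g < f\<close>; finiteness of the integral of
  \<open>g\<close> makes the subtraction of extended integrals legitimate.\<close>

lemma AE_le_of_set_nn_integral_le: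
  fixes f g :: "'a \<Rightarrow> ennreal"
  assumes [measurable]: "f \<in> borel_measurable M" "g \<in> borel_measurable M"
    and fin: "(\<integral>\<^sup>+x. g x \<partial>M) < \<infinity>"
    and le: "\<And>A. A \<in> sets M \<Longrightarrow> (\<integral>\<^sup>+x. f x * indicator A x \<partial>M) \<le> (\<integral>\<^sup>+x. g x * indicator A x \<partial>M)"
  shows "AE x in M. f x \<le> g x"
proof -
  define B where "B = {x \<in> space M. g x < f x}"
  have [measurable]: "B \<in> sets M"
    unfolding B_def by measurable
  have gfin: "(\<integral>\<^sup>+x. g x * indicator B x \<partial>M) < \<infinity>"
    by (rule le_less_trans[OF nn_integral_mono fin]) (auto split: split_indicator)
  have "(\<integral>\<^sup>+x. f x * indicator B x - g x * indicator B x \<partial>M)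
      = (\<integral>\<^sup>+x. f x * indicator B x \<partial>M) - (\<integral>\<^sup>+x. g x * indicator B x \<partial>M)"
    using gfin by (intro nn_integral_diff) (auto simp: B_def intro!: AE_I2 split: split_indicator)
  also have "\<dots> = 0"
    using le[of B] gfin by (auto simp: diff_eq_0_iff_ennreal intro: le_less_trans)
  finally have "AE x in M. f x * indicator B x - g x * indicator B x = 0"
    by (subst (asm) nn_integral_0_iff_AE) auto
  with AE_space show ?thesis
    by eventually_elim (auto simp: B_def diff_eq_0_iff_ennreal indicator_def of_bool_def not_le split: if_splits)
qed

text \<open>For every \<open>t\<close> the measure \<open>A \<mapsto> m (A \<times> {..t})\<close>
  is dominated by the marginal, and its density \<open>G t\<close> is the conditional distribution
  function at \<open>t\<close>, up to a null set depending on \<open>t\<close>. Regularising from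
  the rationals gives a genuine distribution function \<open>F x\<close>, whose
  \<open>interval_measure\<close> is the kernel. Since the fibre coordinate lies in
  \<open>[0, 1]\<close> almost everywhere, \<open>F x\<close> vanishes before 0 and equals 1 from 1
  on, and no mass escapes.\<close>

lemma real_disintegration:
  fixes M :: "'a measure" and m :: "('a \<times> real) measure"
  assumes "prob_space M" "prob_space m"
    and m_sets[measurable_cong]: "sets m = sets (M \<Otimes>\<^sub>M borel)"
    and marg: "distr m M fst = M"
    and supp: "AE z in m. 0 \<le> snd z \<and> snd z \<le> 1"
  obtains K where "K \<in> measurable M (prob_algebra borel)"
    "\<And>S. S \<in> sets m \<Longrightarrow> emeasure m S = (\<integral>\<^sup>+x. emeasure (K x) (Pair x -` S) \<partial>M)"
proof -
  interpret M: prob_space M by fact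
  interpret m: prob_space m by fact
  have sp: "space m = space M \<times> UNIV"
    using sets_eq_imp_space_eq[OF m_sets] by (simp add: space_pair_measure)
  have marg': "emeasure m (A \<times> UNIV) = emeasure M A" if "A \<in> sets M" for A
  proof -
    have "emeasure M A = emeasure (distr m M fst) A" by (simp add: marg)
    also have "\<dots> = emeasure m (fst -` A \<inter> space m)"
      using that by (intro emeasure_distr) auto
    also have "fst -` A \<inter> space m = A \<times> UNIV"
      using sets.sets_into_space[OF that] by (auto simp: sp)
    finally show ?thesis by simp
  qed
  define \<nu> where "\<nu> t = distr (density m (indicator (space M \<times> {..t}))) M fst" for t :: real
  have \<nu>: "emeasure (\<nu> t) A = emeasure m (A \<times> {..t})" if [measurable]: "A \<in> sets M" for t A
  proof -
    have "emeasure (\<nu> t) A = (\<integral>\<^sup>+z. indicator (space M \<times> {..t}) z * indicator (fst -` A \<inter> space m) z \<partial>m)"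
      unfolding \<nu>_def by (simp add: emeasure_distr emeasure_density)
    also have "\<dots> = (\<integral>\<^sup>+z. indicator (A \<times> {..t}) z \<partial>m)"
      using sets.sets_into_space[OF that]
      by (intro nn_integral_cong) (auto simp: sp split: split_indicator)
    finally show ?thesis by simp
  qed
  have ac: "absolutely_continuous M (\<nu> t)" for t
    unfolding absolutely_continuous_def
  proof
    fix A assume A: "A \<in> null_sets M"
    then have [measurable]: "A \<in> sets M" by auto
    have "emeasure (\<nu> t) A \<le> emeasure m (A \<times> UNIV)"
      by (simp add: \<nu>, intro emeasure_mono) auto
    also have "\<dots> = 0" using A by (simp add: marg' null_setsD1)
    finally show "A \<in> null_sets (\<nu> t)"
      by (auto simp: null_sets_def \<nu>_def)
  qed
  define G where "G t = RN_deriv M (\<nu> t)" for t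
  have G_meas[measurable]: "G t \<in> borel_measurable M" for t
    unfolding G_def by simp
  have G: "(\<integral>\<^sup>+x. G t x * indicator A x \<partial>M) = emeasure m (A \<times> {..t})" if [measurable]: "A \<in> sets M" for A t
  proof -
    have "emeasure m (A \<times> {..t}) = emeasure (density M (G t)) A"
      unfolding G_def using M.density_RN_deriv[OF ac] by (simp add: \<nu>_def \<nu>[symmetric])
    then show ?thesis
      by (simp add: emeasure_density)
  qed
  have G_fin: "(\<integral>\<^sup>+x. G t x \<partial>M) < \<infinity>" for t
  proof -
    have "(\<integral>\<^sup>+x. G t x \<partial>M) = (\<integral>\<^sup>+x. G t x * indicator (space M) x \<partial>M)"
      by (intro nn_integral_cong) simp
    also have "\<dots> = emeasure m (space M \<times> {..t})"
      by (rule G) simp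
    also have "\<dots> < \<infinity>"
      by (simp add: m.emeasure_eq_measure)
    finally show ?thesis .
  qed
  \<comment> \<open>Each of the following inequalities has its own null set, depending on the
    parameters. They are then restricted to rational parameters, so that countably many null sets
    remain.\<close>
  have "AE x in M. G r x \<le> G s x" if "r \<le> s" for r s
  proof (rule AE_le_of_set_nn_integral_le)
    fix A assume [measurable]: "A \<in> sets M"
    show "(\<integral>\<^sup>+x. G r x * indicator A x \<partial>M) \<le> (\<integral>\<^sup>+x. G s x * indicator A x \<partial>M)"
      using that by (simp add: G, intro emeasure_mono) auto
  qed (use G_fin in auto)
  then have mono: "AE x in M. \<forall>r s :: rat. r \<le> s \<longrightarrow> G (of_rat r) x \<le> G (of_rat s) x"
    unfolding AE_all_countable by (auto simp: of_rat_less_eq)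
  have "AE x in M. G r x \<le> 1" for r
  proof (rule AE_le_of_set_nn_integral_le)
    fix A assume [measurable]: "A \<in> sets M"
    have "emeasure m (A \<times> {..r}) \<le> emeasure m (A \<times> UNIV)"
      by (intro emeasure_mono) auto
    then show "(\<integral>\<^sup>+x. G r x * indicator A x \<partial>M) \<le> (\<integral>\<^sup>+x. 1 * indicator A x \<partial>M)"
      by (simp add: G marg')
  qed (auto simp: M.emeasure_space_1)
  then have le1: "AE x in M. \<forall>r :: rat. G (of_rat r) x \<le> 1"
    unfolding AE_all_countable by auto
  have "AE x in M. 1 \<le> G r x" if "1 \<le> r" for r
  proof (rule AE_le_of_set_nn_integral_le)
    fix A assume [measurable]: "A \<in> sets M"
    have "emeasure m (A \<times> {..r}) = emeasure m (A \<times> UNIV)"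
      using supp that by (intro emeasure_eq_AE) auto
    then show "(\<integral>\<^sup>+x. 1 * indicator A x \<partial>M) \<le> (\<integral>\<^sup>+x. G r x * indicator A x \<partial>M)"
      by (simp add: G marg')
  qed (use G_fin in auto)
  then have ge1: "AE x in M. \<forall>r :: rat. 1 \<le> r \<longrightarrow> 1 \<le> G (of_rat r) x"
    unfolding AE_all_countable by auto
  have "AE x in M. G r x \<le> 0" if "r < 0" for r
  proof (rule AE_le_of_set_nn_integral_le)
    fix A assume [measurable]: "A \<in> sets M"
    have "emeasure m (A \<times> {..r}) = emeasure m {}"
      using supp that by (intro emeasure_eq_AE) auto
    then show "(\<integral>\<^sup>+x. G r x * indicator A x \<partial>M) \<le> (\<integral>\<^sup>+x. 0 * indicator A x \<partial>M)"
      by (simp add: G)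
  qed auto
  then have le0: "AE x in M. \<forall>r :: rat. r < 0 \<longrightarrow> G (of_rat r) x \<le> 0"
    unfolding AE_all_countable by auto
  define good where "good x \<longleftrightarrow> (\<forall>r s :: rat. r \<le> s \<longrightarrow> G (of_rat r) x \<le> G (of_rat s) x) \<and>
      (\<forall>r :: rat. G (of_rat r) x \<le> 1) \<and> (\<forall>r :: rat. 1 \<le> r \<longrightarrow> 1 \<le> G (of_rat r) x) \<and>
      (\<forall>r :: rat. r < 0 \<longrightarrow> G (of_rat r) x \<le> 0)" for x
  have AE_good: "AE x in M. good x"
    using mono le1 ge1 le0 unfolding good_def by eventually_elim blast
  have [measurable]: "Measurable.pred M good"
    unfolding good_def by measurable
  \<comment> \<open>On the exceptional null set the distribution function of the point mass at 0 is
    substituted, so that \<open>K x\<close> is a probability measure for every \<open>x\<close>, as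
    a kernel into \<open>prob_algebra borel\<close> requires.\<close>
  define g :: "'a \<Rightarrow> rat \<Rightarrow> real"
    where "g x r = (if good x then enn2real (G (of_rat r) x) else of_bool (0 \<le> r))" for x r
  have [measurable]: "(\<lambda>x. g x r) \<in> borel_measurable M" for r
    unfolding g_def by measurable
  have g_mono: "g x r \<le> g x s" if "r \<le> s" for x r s
  proof -
    have "G (of_rat s) x < \<infinity>" if "good x"
      using that unfolding good_def by (metis ennreal_one_less_top infinity_ennreal_def le_less_trans)
    then show ?thesis
      using that by (auto simp: g_def good_def intro!: enn2real_mono)
  qed
  have g0: "0 \<le> g x r" for x r
    by (simp add: g_def)
  have g1: "g x r \<le> 1" for x r
  proof (cases "good x")
    case True
    then have "G (of_rat r) x \<le> 1" by (simp add: good_def)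
    then show ?thesis using True by (simp add: g_def enn2real_leI)
  qed (simp add: g_def)
  have g_neg: "g x r = 0" if "r < 0" for x r
    using that by (auto simp: g_def good_def)
  have g_ge1: "g x r = 1" if "1 \<le> r" for x r
  proof (cases "good x")
    case True
    then have "G (of_rat r) x = 1"
      using that by (auto simp: good_def intro!: antisym)
    then show ?thesis using True by (simp add: g_def)
  qed (use that in \<open>simp add: g_def\<close>)
  define I :: "real \<Rightarrow> rat set" where "I t = {r. t < of_rat r}" for t
  have I_ne: "I t \<noteq> {}" for t
    using of_rat_dense[of t "t + 1"] by (auto simp: I_def)
  \<comment> \<open>Taking the infimum over rationals \<open>r > t\<close> makes the conditional distribution function right-continuous.\<close>
  define F where "F x t = (INF r\<in>I t. g x r)" for x t
  have bdd: "bdd_below (g x ` R)" for x R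
    using g0 by (auto intro!: bdd_belowI[of _ 0])
  have F_le: "F x t \<le> g x r" if "t < of_rat r" for x t r
    unfolding F_def by (rule cINF_lower[OF bdd]) (use that in \<open>simp add: I_def\<close>)
  have F_ge: "c \<le> F x t" if "\<And>r. t < of_rat r \<Longrightarrow> c \<le> g x r" for x t c
    unfolding F_def by (rule cINF_greatest[OF I_ne]) (use that in \<open>simp add: I_def\<close>)
  have F_near: "\<exists>r. t < of_rat r \<and> g x r < c" if "F x t < c" for x t c
    using that unfolding F_def cINF_less_iff[OF I_ne bdd] by (auto simp: I_def)
  have F_mono: "F x s \<le> F x t" if "s \<le> t" for x s t
    by (rule F_ge, rule F_le) (use that in simp)
  have F_0: "F x t = 0" if "t < 0" for x t
  proof -
    obtain r :: rat where r: "t < of_rat r" "of_rat r < (0::real)"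
      using of_rat_dense[OF \<open>t < 0\<close>] by blast
    then have "F x t \<le> 0"
      using F_le[OF r(1), of x] g_neg[of r x] by simp
    moreover have "0 \<le> F x t"
      by (rule F_ge) (rule g0)
    ultimately show ?thesis by simp
  qed
  have F_1: "F x t = 1" if "1 \<le> t" for x t
  proof -
    have "1 \<le> F x t"
    proof (rule F_ge)
      fix r :: rat assume "t < of_rat r"
      then have "1 \<le> r"
        using that by (metis less_le_trans less_imp_le of_rat_1 of_rat_less_eq order_trans)
      then show "1 \<le> g x r" by (simp add: g_ge1)
    qed
    moreover obtain r :: rat where "t < of_rat r"
      using of_rat_dense[of t "t + 1"] by auto
    then have "F x t \<le> 1"
      using F_le[of t r x] g1[of x r] by linarith
    ultimately show ?thesis by simp
  qed
  have F_right: "continuous (at_right a) (F x)" for x a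
    unfolding continuous_within
  proof (rule tendstoI)
    fix e :: real assume "0 < e"
    then obtain r where r: "a < of_rat r" "g x r < F x a + e"
      using F_near[of x a "F x a + e"] by auto
    have "dist (F x t) (F x a) < e" if "a < t" "t < of_rat r" for t
      using F_le[OF that(2), of x] F_mono[of a t x] that r by (simp add: dist_real_def)
    then show "\<forall>\<^sub>F t in at a within {a<..}. dist (F x t) (F x a) < e"
      using r(1) unfolding eventually_at_right_field by blast
  qed
  have F_bot: "(F x \<longlongrightarrow> 0) at_bot" for x
    by (rule tendsto_eventually) (auto simp: eventually_at_bot_dense F_0 intro!: exI[of _ 0])
  have F_top: "(F x \<longlongrightarrow> 1) at_top" for x
    by (rule tendsto_eventually) (auto simp: eventually_at_top_linorder F_1 intro!: exI[of _ 1])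
  define K where "K x = interval_measure (F x)" for x
  have K_dist: "real_distribution (K x)" for x
    unfolding K_def by (rule real_distribution_interval_measure[OF F_mono F_right F_bot F_top])
  have K_cdf: "emeasure (K x) {..t} = ennreal (F x t)" for x t
  proof -
    interpret real_distribution "K x" by (rule K_dist)
    have "cdf (K x) = F x"
      unfolding K_def by (rule cdf_interval_measure[OF F_mono F_right F_bot])
    then show ?thesis
      unfolding emeasure_eq_measure by (metis cdf_def)
  qed
  have [measurable]: "(\<lambda>x. F x t) \<in> borel_measurable M" for t
    unfolding F_def by (rule borel_measurable_cINF_real) auto
  have K_meas: "K \<in> measurable M (prob_algebra borel)"
  proof (rule measurable_prob_algebra_generated)
    show "sets borel = sigma_sets UNIV (range (atMost :: real \<Rightarrow> real set))"
      by (simp add: borel_eq_atMost)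
    show "Int_stable (range (atMost :: real \<Rightarrow> real set))"
      by (auto simp: Int_stable_def)
    show "prob_space (K a)" "sets (K a) = sets borel" for a
      using K_dist[of a] by (auto simp: real_distribution_def real_distribution_axioms_def)
    fix A assume "A \<in> range (atMost :: real \<Rightarrow> real set)"
    then show "(\<lambda>a. emeasure (K a) A) \<in> borel_measurable M"
      by (auto simp: K_cdf)
  qed auto
  have rect: "emeasure m (A \<times> {..t}) = (\<integral>\<^sup>+x. emeasure (K x) {..t} * indicator A x \<partial>M)"
    if [measurable]: "A \<in> sets M" for A t
  proof -
    \<comment> \<open>\<open>F x t\<close> is not compared with \<open>G t x\<close> directly. The
      identity is known at rationals \<open>r n\<close> tending to \<open>t\<close> from the right,
      and both sides pass to the limit. The \<open>r n\<close> need not be monotone, hence dominated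
      convergence on each side.\<close>
    have "\<exists>r :: rat. t < of_rat r \<and> of_rat r < t + 1 / real (Suc n)" for n
      using of_rat_dense[of t "t + 1 / real (Suc n)"] by auto
    then obtain r :: "nat \<Rightarrow> rat" where r: "\<And>n. t < of_rat (r n)" "\<And>n. of_rat (r n) < t + 1 / real (Suc n)"
      by metis
    have r_lim: "(\<lambda>n. of_rat (r n) :: real) \<longlonglongrightarrow> t"
    proof (rule tendsto_sandwich[where f="\<lambda>_. t" and h="\<lambda>n. t + 1 / real (Suc n)"])
      show "(\<lambda>n. t + 1 / real (Suc n)) \<longlonglongrightarrow> t"
        using tendsto_add[OF tendsto_const[of t] LIMSEQ_inverse_real_of_nat] by (simp add: inverse_eq_divide)
    qed (use r in \<open>auto intro!: always_eventually less_imp_le\<close>)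
    have g_lim: "(\<lambda>n. g x (r n)) \<longlonglongrightarrow> F x t" for x
    proof (rule tendstoI)
      fix e :: real assume "0 < e"
      then obtain s where s: "t < of_rat s" "g x s < F x t + e"
        using F_near[of x t "F x t + e"] by auto
      have "\<forall>\<^sub>F n in sequentially. of_rat (r n) < (of_rat s :: real)"
        using r_lim s(1) by (rule order_tendstoD)
      then show "\<forall>\<^sub>F n in sequentially. dist (g x (r n)) (F x t) < e"
      proof eventually_elim
        case (elim n)
        then have "g x (r n) \<le> g x s"
          by (intro g_mono) (simp add: of_rat_less)
        then show ?case
          using s F_le[OF r(1), of x n] by (simp add: dist_real_def)
      qed
    qed
    have "(\<lambda>n. \<integral>\<^sup>+x. ennreal (g x (r n)) * indicator A x \<partial>M) \<longlonglongrightarrow> (\<integral>\<^sup>+x. ennreal (F x t) * indicator A x \<partial>M)"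
    proof (rule nn_integral_dominated_convergence[where w="\<lambda>_. 1"])
      show "AE x in M. (\<lambda>n. ennreal (g x (r n)) * indicator A x) \<longlonglongrightarrow> ennreal (F x t) * indicator A x"
        using g_lim by (intro AE_I2) (auto split: split_indicator intro!: tendsto_ennrealI)
    qed (use g1 in \<open>auto simp: M.emeasure_space_1 split: split_indicator\<close>)
    moreover have "(\<integral>\<^sup>+x. ennreal (g x (r n)) * indicator A x \<partial>M) = emeasure m (A \<times> {..of_rat (r n)})" for n
    proof -
      have "(\<integral>\<^sup>+x. ennreal (g x (r n)) * indicator A x \<partial>M) = (\<integral>\<^sup>+x. G (of_rat (r n)) x * indicator A x \<partial>M)"
      proof (rule nn_integral_cong_AE)
        show "AE x in M. ennreal (g x (r n)) * indicator A x = G (of_rat (r n)) x * indicator A x"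
          using AE_good
        proof eventually_elim
          case (elim x)
          then have "G (of_rat (r n)) x < \<infinity>"
            unfolding good_def by (metis ennreal_one_less_top infinity_ennreal_def le_less_trans)
          then show ?case
            using elim by (simp add: g_def)
        qed
      qed
      then show ?thesis by (simp add: G)
    qed
    ultimately have 1: "(\<lambda>n. emeasure m (A \<times> {..of_rat (r n)})) \<longlonglongrightarrow> (\<integral>\<^sup>+x. ennreal (F x t) * indicator A x \<partial>M)"
      by simp
    have "(\<lambda>n. \<integral>\<^sup>+z. indicator (A \<times> {..of_rat (r n)}) z \<partial>m) \<longlonglongrightarrow> (\<integral>\<^sup>+z. indicator (A \<times> {..t}) z \<partial>m)"
    proof (rule nn_integral_dominated_convergence[where w="\<lambda>_. 1"])
      have "(\<lambda>n. indicator (A \<times> {..of_rat (r n)}) (x, y) :: ennreal) \<longlonglongrightarrow> indicator (A \<times> {..t}) (x, y)" for x y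
      proof (cases "y \<le> t")
        case True
        then have "y \<le> of_rat (r n)" for n
          using r(1)[of n] by linarith
        then show ?thesis
          using True by (auto simp: indicator_def)
      next
        case False
        then have "\<forall>\<^sub>F n in sequentially. of_rat (r n) < y"
          using order_tendstoD(2)[OF r_lim] by simp
        then show ?thesis
          using False by (intro tendsto_eventually) (auto elim!: eventually_mono simp: indicator_def)
      qed
      then show "AE z in m. (\<lambda>n. indicator (A \<times> {..of_rat (r n)}) z :: ennreal) \<longlonglongrightarrow> indicator (A \<times> {..t}) z"
        by (intro AE_I2) auto
    qed (auto simp: m.emeasure_space_1 split: split_indicator)
    then have "(\<lambda>n. emeasure m (A \<times> {..of_rat (r n)})) \<longlonglongrightarrow> emeasure m (A \<times> {..t})"
      by simp
    from LIMSEQ_unique[OF this 1] show ?thesis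
      by (simp add: K_cdf)
  qed
  \<comment> \<open>\<open>N\<close> is the measure rebuilt from marginal and kernel. It is
    identified with \<open>m\<close> on the sets \<open>A \<times> {..t}\<close>, which are stable
    under intersection and generate the product sets.\<close>
  define N where "N = M \<bind> (\<lambda>x. distr (K x) (M \<Otimes>\<^sub>M borel) (Pair x))"
  have K_sub[measurable]: "K \<in> measurable M (subprob_algebra borel)"
    using K_meas by (rule measurable_prob_algebraD)
  have K_pair: "(\<lambda>x. distr (K x) (M \<Otimes>\<^sub>M borel) (Pair x)) \<in> measurable M (subprob_algebra (M \<Otimes>\<^sub>M borel))"
    by (rule measurable_distr2[where M=borel]) auto
  have K_sets[measurable_cong]: "sets (K x) = sets borel" for x
    using K_dist[of x] by (simp add: real_distribution_def real_distribution_axioms_def)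
  have N: "emeasure N S = (\<integral>\<^sup>+x. emeasure (K x) (Pair x -` S) \<partial>M)" if S: "S \<in> sets (M \<Otimes>\<^sub>M borel)" for S
    unfolding N_def emeasure_bind[OF M.not_empty K_pair S]
  proof (rule nn_integral_cong)
    fix x assume x: "x \<in> space M"
    have "Pair x \<in> measurable (K x) (M \<Otimes>\<^sub>M borel)"
      using x by simp
    then show "emeasure (distr (K x) (M \<Otimes>\<^sub>M borel) (Pair x)) S = emeasure (K x) (Pair x -` S)"
      using S K_dist[of x] by (simp add: emeasure_distr real_distribution.space_eq_univ)
  qed
  have sets_N: "sets N = sets (M \<Otimes>\<^sub>M borel)"
    unfolding N_def by (rule sets_bind[OF _ M.not_empty]) simp
  define E where "E = {a \<times> b | a b. a \<in> sets M \<and> b \<in> range (atMost :: real \<Rightarrow> real set)}"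
  have gen: "sets (M \<Otimes>\<^sub>M borel) = sigma_sets (space M \<times> UNIV) E"
  proof -
    have "sets (M \<Otimes>\<^sub>M (borel :: real measure)) = sets (sigma (space M \<times> space (borel :: real measure)) E)"
      unfolding E_def
    proof (rule sets_pair_eq[where Ca="{space M}" and Cb="range (\<lambda>n::nat. {..real n})"])
      show "sets M = sigma_sets (space M) (sets M)"
        by (simp add: sets.sigma_sets_eq)
      show "sets borel = sigma_sets (space borel) (range (atMost :: real \<Rightarrow> real set))"
        by (simp add: borel_eq_atMost)
      show "\<Union> (range (\<lambda>n::nat. {..real n})) = space borel"
        using real_arch_simple by auto
    qed (auto dest: sets.sets_into_space)
    also have "\<dots> = sigma_sets (space M \<times> UNIV) E"
      by (subst sets_measure_of) (auto simp: E_def dest: sets.sets_into_space)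
    finally show ?thesis .
  qed
  have "m = N"
  proof (rule measure_eqI_generator_eq[where E=E and \<Omega>="space M \<times> UNIV" and A="\<lambda>n::nat. space M \<times> {..real n}"])
    show "Int_stable E"
      unfolding Int_stable_def
    proof (intro ballI)
      fix a b assume "a \<in> E" "b \<in> E"
      then obtain A s B t where "a = A \<times> {..s}" "b = B \<times> {..t}" "A \<in> sets M" "B \<in> sets M"
        by (auto simp: E_def)
      then have "a \<inter> b = (A \<inter> B) \<times> {..min s t}" "A \<inter> B \<in> sets M"
        by auto
      then show "a \<inter> b \<in> E"
        unfolding E_def by blast
    qed
    show "E \<subseteq> Pow (space M \<times> UNIV)"
      by (auto simp: E_def dest: sets.sets_into_space)
    show "sets m = sigma_sets (space M \<times> UNIV) E" "sets N = sigma_sets (space M \<times> UNIV) E"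
      using gen m_sets sets_N by auto
    show "range (\<lambda>n. space M \<times> {..real n}) \<subseteq> E"
      by (auto simp: E_def)
    show "(\<Union>n. space M \<times> {..real n}) = space M \<times> UNIV"
      using real_arch_simple by auto
    show "emeasure m (space M \<times> {..real n}) \<noteq> \<infinity>" for n
      by (simp add: m.emeasure_eq_measure)
    fix X assume "X \<in> E"
    then obtain A t where X: "X = A \<times> {..t}" and A[measurable]: "A \<in> sets M"
      by (auto simp: E_def)
    have "emeasure N X = (\<integral>\<^sup>+x. emeasure (K x) (Pair x -` X) \<partial>M)"
      by (rule N) (simp add: X)
    also have "\<dots> = (\<integral>\<^sup>+x. emeasure (K x) {..t} * indicator A x \<partial>M)"
      by (intro nn_integral_cong) (auto simp: X split: split_indicator)
    finally show "emeasure m X = emeasure N X"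
      by (simp add: X rect)
  qed
  then show ?thesis
    using that[OF K_meas] N m_sets by metis
qed

section \<open>Disintegration with compact fibres\<close>

text \<open>The fibre is coded into the reals, the image measure is disintegrated there, and the
  kernel is carried back by the decoder \<open>q\<close>.\<close>

lemma Rokhlin_disintegration:
  fixes m :: "('m::{metric_space, second_countable_topology} \<times> 'e::{metric_space, second_countable_topology}) measure"
  assumes "compact (UNIV :: 'e set)" "borel_probability \<mu>" "borel_probability m" "projects_to m \<mu>"
  obtains \<kappa> where "disintegration \<mu> m \<kappa>"
proof -
  have "sets m = sets borel" and [measurable_cong]: "sets \<mu> = sets borel"
    and prob: "prob_space \<mu>" "prob_space m"
    using assms by (auto simp: borel_probability_def)
  have [measurable_cong]: "sets m = sets (borel \<Otimes>\<^sub>M borel)"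
    unfolding borel_prod by fact
  interpret m: prob_space m by (fact prob)
  have sp: "space m = UNIV" "space \<mu> = UNIV"
    using sets_eq_imp_space_eq[OF \<open>sets m = sets borel\<close>] sets_eq_imp_space_eq[OF \<open>sets \<mu> = sets borel\<close>] by auto
  obtain \<iota> :: "'e \<Rightarrow> real" and q :: "real \<Rightarrow> 'e"
    where [measurable]: "\<iota> \<in> borel_measurable borel" "q \<in> borel_measurable borel"
      and q: "\<And>\<xi>. q (\<iota> \<xi>) = \<xi>" and \<iota>: "\<And>\<xi>. 0 \<le> \<iota> \<xi>" "\<And>\<xi>. \<iota> \<xi> \<le> 1"
    using compact_metric_real_coding[OF assms(1)] by metis
  let ?j = "\<lambda>(x, \<xi>). (x, \<iota> \<xi>)"
  define m' where "m' = distr m (\<mu> \<Otimes>\<^sub>M borel) ?j"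
  have j[measurable]: "?j \<in> measurable m (\<mu> \<Otimes>\<^sub>M borel)"
    by measurable
  have "prob_space m'"
    unfolding m'_def by (rule m.prob_space_distr) simp
  moreover have sets_m': "sets m' = sets (\<mu> \<Otimes>\<^sub>M borel)"
    by (simp add: m'_def)
  moreover have "distr m' \<mu> fst = \<mu>"
  proof -
    have "distr m' \<mu> fst = distr m \<mu> (fst \<circ> ?j)"
      unfolding m'_def by (rule distr_distr) auto
    also have "\<dots> = distr m borel fst"
      by (rule distr_cong) (auto simp: o_def \<open>sets \<mu> = sets borel\<close>)
    finally show ?thesis
      using assms(4) by (simp add: projects_to_def)
  qed
  moreover have "AE z in m'. 0 \<le> snd z \<and> snd z \<le> 1"
    unfolding m'_def by (subst AE_distr_iff) (auto simp: \<iota>)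
  ultimately obtain K where K[measurable]: "K \<in> measurable \<mu> (prob_algebra borel)"
    and m'_eq: "\<And>S. S \<in> sets m' \<Longrightarrow> emeasure m' S = (\<integral>\<^sup>+x. emeasure (K x) (Pair x -` S) \<partial>\<mu>)"
    by (rule real_disintegration[OF prob(1)]) blast
  have K_sets[measurable_cong]: "sets (K x) = sets borel" for x
    using measurable_space[OF K, of x] by (simp add: sp space_prob_algebra)
  define \<kappa> where "\<kappa> x = distr (K x) borel q" for x
  have "disintegration \<mu> m \<kappa>"
    unfolding disintegration_def
  proof (intro conjI ballI)
    have "\<kappa> \<in> measurable \<mu> (prob_algebra borel)"
      unfolding \<kappa>_def by (rule measurable_compose[OF K measurable_distr_prob_space]) simp
    then show "\<kappa> \<in> measurable borel (prob_algebra borel)"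
      by (simp add: measurable_cong_sets[OF \<open>sets \<mu> = sets borel\<close> refl])
    fix S :: "('m \<times> 'e) set" assume S: "S \<in> sets borel"
    \<comment> \<open>Pulling \<open>S\<close> back along the decoder and then along the encoder
      returns \<open>S\<close>, because \<open>q (\<iota> \<xi>) = \<xi>\<close>. Thus the formula
      for \<open>m'\<close> at \<open>?S\<close> becomes the formula for \<open>m\<close> at
      \<open>S\<close>.\<close>
    let ?S = "{z \<in> space (\<mu> \<Otimes>\<^sub>M borel). (fst z, q (snd z)) \<in> S}"
    have [measurable]: "(\<lambda>z. (fst z, q (snd z))) \<in> measurable (\<mu> \<Otimes>\<^sub>M borel) borel"
      unfolding borel_prod[symmetric] by measurable
    have S'[measurable]: "?S \<in> sets (\<mu> \<Otimes>\<^sub>M borel)"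
      using S by measurable
    have "emeasure m' ?S = emeasure m (?j -` ?S \<inter> space m)"
      unfolding m'_def by (rule emeasure_distr) auto
    also have "?j -` ?S \<inter> space m = S"
      by (auto simp: sp q space_pair_measure)
    finally have "emeasure m S = (\<integral>\<^sup>+x. emeasure (K x) (Pair x -` ?S) \<partial>\<mu>)"
      using m'_eq[of ?S] S' sets_m' by simp
    also have "\<dots> = (\<integral>\<^sup>+x. emeasure (\<kappa> x) (Pair x -` S) \<partial>\<mu>)"
    proof (rule nn_integral_cong)
      fix x
      have V[measurable]: "Pair x -` S \<in> sets borel"
        using S measurable_Pair1'[of x borel borel]
        by (metis borel_prod measurable_sets_borel space_borel UNIV_I)
      have "space (K x) = UNIV"
        using sets_eq_imp_space_eq[OF K_sets] by simp
      then show "emeasure (K x) (Pair x -` ?S) = emeasure (\<kappa> x) (Pair x -` S)"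
        unfolding \<kappa>_def using V by (subst emeasure_distr) (auto simp: sp space_pair_measure vimage_def)
    qed
    finally show "emeasure m S = (\<integral>\<^sup>+x. emeasure (\<kappa> x) (Pair x -` S) \<partial>\<mu>)" .
  qed
  then show ?thesis by (rule that)
qed

lemma disintegration_kernel:
  assumes "disintegration \<mu> m \<kappa>"
  shows "sets (\<kappa> x) = sets borel" "prob_space (\<kappa> x)" "space (\<kappa> x) = UNIV"
proof -
  have "\<kappa> x \<in> space (prob_algebra borel)"
    using assms by (auto simp: disintegration_def intro: measurable_space)
  then show "sets (\<kappa> x) = sets borel" "prob_space (\<kappa> x)"
    by (auto simp: space_prob_algebra)
  then show "space (\<kappa> x) = UNIV"
    using sets_eq_imp_space_eq by fastforce
qed

lemma disintegration_integral_measurable: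
  assumes "disintegration \<mu> m \<kappa>" and [measurable]: "\<phi> \<in> borel_measurable borel"
  shows "(\<lambda>x. \<integral>\<xi>. \<phi> \<xi> \<partial>\<kappa> x :: real) \<in> borel_measurable borel"
proof (rule measurable_compose[OF _ integral_measurable_subprob_algebra])
  show "\<kappa> \<in> measurable borel (subprob_algebra borel)"
    using assms(1) by (auto simp: disintegration_def intro: measurable_prob_algebraD)
qed simp

text \<open>With \<open>P x\<close> the measure \<open>\<kappa> x\<close> placed on the fibre over
  \<open>x\<close>, the defining formula on sets says \<open>m = \<mu> \<bind> P\<close>, and
  integrals against a bind are iterated integrals.\<close>

lemma disintegration_integral:
  fixes m :: "('m::{metric_space, second_countable_topology} \<times> 'e::{metric_space, second_countable_topology}) measure"
    and \<phi> :: "'m \<times> 'e \<Rightarrow> real"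
  assumes "borel_probability \<mu>" "borel_probability m" and dis: "disintegration \<mu> m \<kappa>"
    and meas[measurable]: "\<phi> \<in> borel_measurable borel" and bound: "\<And>z. \<bar>\<phi> z\<bar> \<le> C"
  shows "(\<integral>z. \<phi> z \<partial>m) = (\<integral>x. (\<integral>\<xi>. \<phi> (x, \<xi>) \<partial>\<kappa> x) \<partial>\<mu>)"
proof -
  have \<mu>_sets[measurable_cong]: "sets \<mu> = sets borel" and m_sets: "sets m = sets borel" and "prob_space \<mu>"
    using assms by (auto simp: borel_probability_def)
  interpret \<mu>: prob_space \<mu> by fact
  note \<kappa> = disintegration_kernel[OF dis]
  define P where "P x = distr (\<kappa> x) borel (Pair x)" for x
  have [measurable]: "(Pair x :: 'e \<Rightarrow> 'm \<times> 'e) \<in> borel_measurable borel" for x :: 'm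
    unfolding borel_prod[symmetric] by measurable
  have \<kappa>_meas: "\<kappa> \<in> measurable \<mu> (prob_algebra borel)"
    using dis by (simp add: disintegration_def measurable_cong_sets[OF \<mu>_sets refl])
  have P_meas: "P \<in> measurable \<mu> (prob_algebra borel)"
    unfolding P_def
  proof (rule measurable_distr_prob_space2[OF \<kappa>_meas])
    have "(\<lambda>z. z) \<in> measurable (\<mu> \<Otimes>\<^sub>M borel) (borel :: ('m \<times> 'e) measure)"
      unfolding borel_prod[symmetric] by measurable
    then show "(\<lambda>(x, y). (x, y)) \<in> measurable (\<mu> \<Otimes>\<^sub>M borel) (borel :: ('m \<times> 'e) measure)"
      by (simp add: case_prod_beta)
  qed
  then have P_sub: "P \<in> measurable \<mu> (subprob_algebra borel)"
    by (rule measurable_prob_algebraD)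
  have "m = \<mu> \<bind> P"
  proof (rule measure_eqI)
    show "sets m = sets (\<mu> \<bind> P)"
      using m_sets sets_bind[of \<mu> P borel] \<mu>.not_empty by (simp add: P_def)
    fix S assume "S \<in> sets m"
    then have S[measurable]: "S \<in> sets borel" by (simp add: m_sets)
    have "emeasure (\<mu> \<bind> P) S = (\<integral>\<^sup>+x. emeasure (P x) S \<partial>\<mu>)"
      by (rule emeasure_bind[OF \<mu>.not_empty P_sub S])
    also have "\<dots> = (\<integral>\<^sup>+x. emeasure (\<kappa> x) (Pair x -` S) \<partial>\<mu>)"
      by (intro nn_integral_cong)
        (simp add: P_def emeasure_distr \<kappa> measurable_cong_sets[OF \<kappa>(1) refl])
    finally show "emeasure m S = emeasure (\<mu> \<bind> P) S"
      using dis S by (simp add: disintegration_def)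
  qed
  then have "(\<integral>z. \<phi> z \<partial>m) = (\<integral>x. (\<integral>z. \<phi> z \<partial>P x) \<partial>\<mu>)"
    using integral_bind[OF meas bound P_sub \<mu>.finite_measure_axioms, of 1]
      measurable_space[OF P_meas] by (simp add: space_prob_algebra prob_space.emeasure_space_1)
  also have "\<dots> = (\<integral>x. (\<integral>\<xi>. \<phi> (x, \<xi>) \<partial>\<kappa> x) \<partial>\<mu>)"
    unfolding P_def
    by (intro Bochner_Integration.integral_cong refl integral_distr)
      (simp_all add: measurable_cong_sets[OF \<kappa>(1) refl])
  finally show ?thesis .
qed

section \<open>Weak-star limits\<close>

text \<open>Functions of the base point alone have the same integral against every
  \<open>ms k\<close>, so their limit is that integral.\<close>

lemma projects_to_weak_star_limit:
  fixes ms :: "nat \<Rightarrow> ('m::{metric_space, second_countable_topology} \<times> 'e::{metric_space, second_countable_topology}) measure"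
  assumes "borel_probability \<mu>" "borel_probability m" "\<And>k. borel_probability (ms k)"
    and proj: "\<And>k. projects_to (ms k) \<mu>" and weak: "weak_star_tendsto ms m"
  shows "projects_to m \<mu>"
proof -
  have sets: "sets \<mu> = sets borel" "sets m = sets borel" "\<And>k. sets (ms k) = sets borel"
    and prob: "prob_space \<mu>" "prob_space m" "\<And>k. prob_space (ms k)"
    using assms by (auto simp: borel_probability_def)
  have fst_meas: "(fst :: 'm \<times> 'e \<Rightarrow> 'm) \<in> borel_measurable borel"
    unfolding borel_prod[symmetric] by (rule measurable_fst)
  have fst_m[measurable]: "fst \<in> borel_measurable m" and fst_ms[measurable]: "\<And>k. fst \<in> borel_measurable (ms k)"
    using fst_meas by (simp_all add: measurable_cong_sets[OF sets(2) refl] measurable_cong_sets[OF sets(3) refl])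
  have "distr m borel fst = \<mu>"
  proof (rule finite_measure_eqI_continuous)
    show "finite_measure (distr m borel fst)" "finite_measure \<mu>"
      using prob prob_space.prob_space_distr[OF prob(2) fst_m] by (auto simp: prob_space_def)
    fix \<phi> :: "'m \<Rightarrow> real" assume \<phi>: "continuous_on UNIV \<phi>" "bounded (range \<phi>)"
    then have [measurable]: "\<phi> \<in> borel_measurable borel"
      by (intro borel_measurable_continuous_onI)
    have "continuous_on UNIV (\<lambda>z::'m \<times> 'e. \<phi> (fst z))"
      by (rule continuous_on_compose2[OF \<phi>(1)]) (auto intro: continuous_intros)
    moreover have "bounded (range (\<lambda>z::'m \<times> 'e. \<phi> (fst z)))"
      by (rule bounded_subset[OF \<phi>(2)]) auto
    ultimately have "(\<lambda>k. \<integral>z. \<phi> (fst z) \<partial>ms k) \<longlonglongrightarrow> (\<integral>z. \<phi> (fst z) \<partial>m)"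
      using weak unfolding weak_star_tendsto_def by blast
    moreover have "(\<integral>z. \<phi> (fst z) \<partial>ms k) = (\<integral>x. \<phi> x \<partial>\<mu>)" for k
      using proj[of k] integral_distr[OF fst_ms, of \<phi> k] by (simp add: projects_to_def)
    ultimately have "(\<integral>z. \<phi> (fst z) \<partial>m) = (\<integral>x. \<phi> x \<partial>\<mu>)"
      by (simp add: LIMSEQ_const_iff)
    then show "integral\<^sup>L (distr m borel fst) \<phi> = integral\<^sup>L \<mu> \<phi>"
      by (simp add: integral_distr)
  qed (use sets in auto)
  then show ?thesis by (simp add: projects_to_def)
qed

text \<open>
  The common marginal is what makes this work: replacing \<open>h\<close> by a continuous function close to it in
  \<open>L\<^sup>1(\<mu>)\<close> costs the same small error for all \<open>k\<close>.
\<close>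

lemma weak_star_tendsto_fixed_marginal:
  fixes ms :: "nat \<Rightarrow> ('m::{metric_space, second_countable_topology} \<times> 'e::{metric_space, second_countable_topology}) measure"
    and h :: "'m \<Rightarrow> real" and \<phi> :: "'e \<Rightarrow> real"
  assumes "borel_probability \<mu>" "borel_probability m" "\<And>k. borel_probability (ms k)"
    and proj: "projects_to m \<mu>" "\<And>k. projects_to (ms k) \<mu>" and weak: "weak_star_tendsto ms m"
    and h[measurable]: "h \<in> borel_measurable borel" and h_le: "\<And>x. \<bar>h x\<bar> \<le> C"
    and \<phi>: "continuous_on UNIV \<phi>" and \<phi>_le: "\<And>\<xi>. \<bar>\<phi> \<xi>\<bar> \<le> B"
  shows "(\<lambda>k. \<integral>z. h (fst z) * \<phi> (snd z) \<partial>ms k) \<longlonglongrightarrow> (\<integral>z. h (fst z) * \<phi> (snd z) \<partial>m)"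
proof (rule LIMSEQ_I)
  fix e :: real assume e: "0 < e"
  have \<mu>_sets[measurable_cong]: "sets \<mu> = sets borel" and "prob_space \<mu>"
    using assms by (auto simp: borel_probability_def)
  then interpret \<mu>: prob_space \<mu> by simp
  have [measurable]: "\<phi> \<in> borel_measurable borel"
    using \<phi> by (rule borel_measurable_continuous_onI)
  have B: "0 \<le> B" using \<phi>_le[of undefined] by linarith
  have h_int: "integrable \<mu> h"
    by (rule \<mu>.integrable_const_bound[where B=C]) (use h_le in auto)
  \<comment> \<open>After multiplication by \<open>\<phi>\<close>, bounded by \<open>B\<close>, the
    replacement of \<open>h\<close> costs at most \<open>e / 4\<close>. It is paid once for
    \<open>m\<close> and once for \<open>ms k\<close>, and weak* convergence adds less than
    \<open>e / 4\<close>.\<close>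
  have "0 < e / (4 * (B + 1))" using e B by simp
  then obtain c where c: "continuous_on UNIV c" "bounded (range c)" "(\<integral>x. \<bar>h x - c x\<bar> \<partial>\<mu>) < e / (4 * (B + 1))"
    by (rule continuous_dense_L1[OF \<mu>.finite_measure_axioms \<mu>_sets h_int])
  obtain b where b: "\<And>x. \<bar>c x\<bar> \<le> b"
    using c(2) by (auto simp: bounded_iff)
  have [measurable]: "c \<in> borel_measurable borel"
    using c(1) by (rule borel_measurable_continuous_onI)
  have close: "\<bar>(\<integral>z. h (fst z) * \<phi> (snd z) \<partial>\<nu>) - (\<integral>z. c (fst z) * \<phi> (snd z) \<partial>\<nu>)\<bar> \<le> e / 4"
    if "borel_probability \<nu>" "projects_to \<nu> \<mu>" for \<nu> :: "('m \<times> 'e) measure"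
  proof -
    have "prob_space \<nu>" and \<nu>_sets: "sets \<nu> = sets borel"
      using that by (auto simp: borel_probability_def)
    interpret \<nu>: prob_space \<nu> by fact
    have [measurable_cong]: "sets \<nu> = sets (borel \<Otimes>\<^sub>M borel)"
      unfolding borel_prod by fact
    have fst: "fst \<in> borel_measurable \<nu>" by measurable
    have b0: "0 \<le> b" "0 \<le> C" using b[of undefined] h_le[of undefined] by linarith+
    have i1: "integrable \<nu> (\<lambda>z. h (fst z) * \<phi> (snd z))"
      by (rule \<nu>.integrable_const_bound[where B="C * B"])
        (use h_le \<phi>_le b0 B in \<open>auto simp: abs_mult intro!: mult_mono\<close>)
    have i2: "integrable \<nu> (\<lambda>z. c (fst z) * \<phi> (snd z))"
      by (rule \<nu>.integrable_const_bound[where B="b * B"])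
        (use b \<phi>_le b0 B in \<open>auto simp: abs_mult intro!: mult_mono\<close>)
    have i3: "integrable \<nu> (\<lambda>z. \<bar>h (fst z) - c (fst z)\<bar>)"
    proof (rule \<nu>.integrable_const_bound[where B="C + b"])
      have "\<bar>h x - c x\<bar> \<le> C + b" for x
        using h_le[of x] b[of x] by linarith
      then show "AE z in \<nu>. norm \<bar>h (fst z) - c (fst z)\<bar> \<le> C + b" by simp
    qed measurable
    have "\<bar>(\<integral>z. h (fst z) * \<phi> (snd z) \<partial>\<nu>) - (\<integral>z. c (fst z) * \<phi> (snd z) \<partial>\<nu>)\<bar>
        = \<bar>\<integral>z. (h (fst z) - c (fst z)) * \<phi> (snd z) \<partial>\<nu>\<bar>"
      using i1 i2 by (simp add: left_diff_distrib)
    also have "\<dots> \<le> (\<integral>z. \<bar>(h (fst z) - c (fst z)) * \<phi> (snd z)\<bar> \<partial>\<nu>)"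
      by (rule integral_abs_bound)
    also have "\<dots> \<le> (\<integral>z. \<bar>h (fst z) - c (fst z)\<bar> * B \<partial>\<nu>)"
    proof (rule integral_mono)
      show "integrable \<nu> (\<lambda>z. \<bar>(h (fst z) - c (fst z)) * \<phi> (snd z)\<bar>)"
        using Bochner_Integration.integrable_diff[OF i1 i2] by (simp add: left_diff_distrib)
      show "\<bar>(h (fst z) - c (fst z)) * \<phi> (snd z)\<bar> \<le> \<bar>h (fst z) - c (fst z)\<bar> * B" for z
        unfolding abs_mult by (intro mult_left_mono \<phi>_le) auto
    qed (use i3 in auto)
    also have "\<dots> = (\<integral>x. \<bar>h x - c x\<bar> \<partial>\<mu>) * B"
      using that(2) integral_distr[OF fst, of "\<lambda>x. \<bar>h x - c x\<bar>"] by (simp add: projects_to_def)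
    also have "\<dots> \<le> (e / (4 * (B + 1))) * (B + 1)"
      using c(3) B e by (intro mult_mono) auto
    also have "\<dots> = e / 4" using B by (simp add: field_simps)
    finally show ?thesis .
  qed
  have "continuous_on UNIV (\<lambda>z::'m \<times> 'e. c (fst z) * \<phi> (snd z))"
    by (intro continuous_on_mult continuous_on_compose2[OF c(1)] continuous_on_compose2[OF \<phi>])
      (auto intro: continuous_intros)
  moreover have "bounded (range (\<lambda>z::'m \<times> 'e. c (fst z) * \<phi> (snd z)))"
  proof (rule boundedI)
    fix y assume "y \<in> range (\<lambda>z::'m \<times> 'e. c (fst z) * \<phi> (snd z))"
    then obtain x \<xi> where "y = c x * \<phi> \<xi>" by auto
    moreover have "0 \<le> b" using b[of undefined] by linarith
    ultimately show "norm y \<le> b * B"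
      using b[of x] \<phi>_le[of \<xi>] by (auto simp: abs_mult intro!: mult_mono)
  qed
  ultimately have c_lim: "(\<lambda>k. \<integral>z. c (fst z) * \<phi> (snd z) \<partial>ms k) \<longlonglongrightarrow> (\<integral>z. c (fst z) * \<phi> (snd z) \<partial>m)"
    using weak unfolding weak_star_tendsto_def by blast
  have "0 < e / 4" using e by simp
  from LIMSEQ_D[OF c_lim this] obtain N where N: "\<And>k. k \<ge> N \<Longrightarrow> \<bar>(\<integral>z. c (fst z) * \<phi> (snd z) \<partial>ms k) - (\<integral>z. c (fst z) * \<phi> (snd z) \<partial>m)\<bar> < e / 4"
    unfolding real_norm_def by blast
  have "norm ((\<integral>z. h (fst z) * \<phi> (snd z) \<partial>ms k) - (\<integral>z. h (fst z) * \<phi> (snd z) \<partial>m)) < e" if "k \<ge> N" for k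
    using N[OF that] close[OF assms(2) proj(1)] close[OF assms(3) proj(2), of k] e
    unfolding real_norm_def by argo
  then show "\<exists>N. \<forall>k\<ge>N. norm ((\<integral>z. h (fst z) * \<phi> (snd z) \<partial>ms k) - (\<integral>z. h (fst z) * \<phi> (snd z) \<partial>m)) < e"
    by blast
qed

lemma bounded_continuous_on_compact:
  fixes \<phi> :: "'e::metric_space \<Rightarrow> real"
  assumes "compact (UNIV :: 'e set)" "continuous_on UNIV \<phi>"
  obtains b where "\<And>\<xi>. \<bar>\<phi> \<xi>\<bar> \<le> b"
  using compact_imp_bounded[OF compact_continuous_image[OF assms(2,1)]] by (auto simp: bounded_iff)

lemma prob_space_abs_integral_le:
  fixes f :: "'a \<Rightarrow> real"
  assumes "prob_space M" "f \<in> borel_measurable M" "\<And>x. \<bar>f x\<bar> \<le> b"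
  shows "\<bar>\<integral>x. f x \<partial>M\<bar> \<le> b"
proof -
  interpret prob_space M by fact
  have "integrable M f"
    by (rule integrable_const_bound[where B=b]) (use assms in auto)
  then have "\<bar>\<integral>x. f x \<partial>M\<bar> \<le> (\<integral>x. b \<partial>M)"
    by (intro integral_abs_bound[THEN order_trans] integral_mono) (use assms in auto)
  then show ?thesis by (simp add: prob_space)
qed

text \<open>For a dense sequence of test functions \<open>\<phi> j\<close>, the deviations
  \<open>d j k\<close> of the fibre integrals from their limits become uncorrelated as
  \<open>k\<close> grows. One sparse subsequence and one null set then serve every \<open>j\<close>,
  and uniform approximation extends the convergence to all continuous functions.\<close>

lemma disintegrations_average_converge:
  fixes ms :: "nat \<Rightarrow> ('m::{metric_space, second_countable_topology} \<times> 'e::{metric_space, second_countable_topology}) measure"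
  assumes E: "compact (UNIV :: 'e set)"
    and \<mu>: "borel_probability \<mu>" and m: "borel_probability m" and ms: "\<And>k. borel_probability (ms k)"
    and proj: "projects_to m \<mu>" "\<And>k. projects_to (ms k) \<mu>" and weak: "weak_star_tendsto ms m"
    and dis: "disintegration \<mu> m \<kappa>" "\<And>k. disintegration \<mu> (ms k) (\<kappa>s k)"
  obtains \<sigma> :: "nat \<Rightarrow> nat" and M where "strict_mono \<sigma>" "M \<in> sets borel" "emeasure \<mu> M = 1"
    "\<And>x \<phi>. x \<in> M \<Longrightarrow> continuous_on UNIV \<phi> \<Longrightarrow>
      (\<lambda>n. (\<Sum>i<n\<^sup>2. \<integral>\<xi>. \<phi> \<xi> \<partial>\<kappa>s (\<sigma> i) x) / real (n\<^sup>2)) \<longlonglongrightarrow> (\<integral>\<xi>. \<phi> \<xi> \<partial>\<kappa> x)"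
proof -
  have \<mu>_sets[measurable_cong]: "sets \<mu> = sets borel" and \<mu>_prob: "prob_space \<mu>"
    using \<mu> by (auto simp: borel_probability_def)
  interpret \<mu>: prob_space \<mu> by fact
  obtain \<phi> :: "nat \<Rightarrow> 'e \<Rightarrow> real" where \<phi>: "\<And>j. continuous_on UNIV (\<phi> j)"
    and \<phi>_dense: "\<And>\<psi> e. continuous_on UNIV \<psi> \<Longrightarrow> 0 < e \<Longrightarrow> \<exists>j. \<forall>\<xi>. \<bar>\<psi> \<xi> - \<phi> j \<xi>\<bar> < e"
    using separable_continuous_functions[OF E] by metis
  have [measurable]: "\<phi> j \<in> borel_measurable borel" for j
    using \<phi> by (rule borel_measurable_continuous_onI)
  have "\<exists>b. \<forall>\<xi>. \<bar>\<phi> j \<xi>\<bar> \<le> b" for j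
    using bounded_continuous_on_compact[OF E \<phi>] by metis
  then obtain B where B: "\<And>j \<xi>. \<bar>\<phi> j \<xi>\<bar> \<le> B j"
    by metis
  have B0: "0 \<le> B j" for j using B[of j undefined] by linarith
  define d where "d j k x = (\<integral>\<xi>. \<phi> j \<xi> \<partial>\<kappa>s k x) - (\<integral>\<xi>. \<phi> j \<xi> \<partial>\<kappa> x)" for j k x
  have g_meas[measurable]: "(\<lambda>x. \<integral>\<xi>. \<phi> j \<xi> \<partial>\<kappa> x) \<in> borel_measurable borel"
    "(\<lambda>x. \<integral>\<xi>. \<phi> j \<xi> \<partial>\<kappa>s k x) \<in> borel_measurable borel" for j k
    using dis by (auto intro!: disintegration_integral_measurable)
  have d_meas[measurable]: "d j k \<in> borel_measurable borel" for j k
    unfolding d_def by measurable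
  have g_le: "\<bar>\<integral>\<xi>. \<phi> j \<xi> \<partial>\<kappa> x\<bar> \<le> B j" "\<bar>\<integral>\<xi>. \<phi> j \<xi> \<partial>\<kappa>s k x\<bar> \<le> B j" for j k x
    by (rule prob_space_abs_integral_le[OF disintegration_kernel(2)[OF dis(1)]];
        simp add: B measurable_cong_sets[OF disintegration_kernel(1)[OF dis(1)] refl])
      (rule prob_space_abs_integral_le[OF disintegration_kernel(2)[OF dis(2)]];
        simp add: B measurable_cong_sets[OF disintegration_kernel(1)[OF dis(2)] refl])
  have d_le: "\<bar>d j k x\<bar> \<le> 2 * B j" for j k x
    using g_le(1)[of x j] g_le(2)[of k x j] by (simp add: d_def)
  have prod_le: "\<bar>d j l x * d j k x\<bar> \<le> (2 * B j) * (2 * B j)" for j l k x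
    unfolding abs_mult by (intro mult_mono d_le) (use B0 in auto)
  define r where "r j l k = (\<integral>x. d j l x * d j k x \<partial>\<mu>)" for j l k
  \<comment> \<open>For fixed \<open>l\<close>, the deviation \<open>d j l\<close> is itself used as
    the weight \<open>h\<close>. It is merely Borel in the base point, which is why plain weak*
    convergence has to be strengthened to \<open>weak_star_tendsto_fixed_marginal\<close>.\<close>
  have "(\<lambda>k. r j l k) \<longlonglongrightarrow> 0" for j l
  proof -
    have fub: "(\<integral>z. d j l (fst z) * \<phi> j (snd z) \<partial>\<nu>) = (\<integral>x. d j l x * (\<integral>\<xi>. \<phi> j \<xi> \<partial>\<kappa>' x) \<partial>\<mu>)"
      if "borel_probability \<nu>" "disintegration \<mu> \<nu> \<kappa>'" for \<nu> :: "('m \<times> 'e) measure" and \<kappa>'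
    proof (subst disintegration_integral[OF \<mu> that, where C="2 * B j * B j"])
      show "(\<lambda>z. d j l (fst z) * \<phi> j (snd z)) \<in> borel_measurable borel"
        unfolding borel_prod[symmetric] by measurable
      show "\<bar>d j l (fst z) * \<phi> j (snd z)\<bar> \<le> 2 * B j * B j" for z :: "'m \<times> 'e"
        unfolding abs_mult by (intro mult_mono d_le B) (use B0 in auto)
    qed simp
    have int: "integrable \<mu> (\<lambda>x. d j l x * (\<integral>\<xi>. \<phi> j \<xi> \<partial>\<kappa> x))"
      "integrable \<mu> (\<lambda>x. d j l x * (\<integral>\<xi>. \<phi> j \<xi> \<partial>\<kappa>s k x))" for k
      by (rule \<mu>.integrable_const_bound[where B="2 * B j * B j"];
          simp add: abs_mult mult_mono d_le g_le B0)+
    have "(\<lambda>k. \<integral>z. d j l (fst z) * \<phi> j (snd z) \<partial>ms k) \<longlonglongrightarrow> (\<integral>z. d j l (fst z) * \<phi> j (snd z) \<partial>m)"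
      by (rule weak_star_tendsto_fixed_marginal[OF \<mu> m ms proj weak d_meas d_le \<phi> B])
    then have "(\<lambda>k. \<integral>x. d j l x * (\<integral>\<xi>. \<phi> j \<xi> \<partial>\<kappa>s k x) \<partial>\<mu>) \<longlonglongrightarrow> (\<integral>x. d j l x * (\<integral>\<xi>. \<phi> j \<xi> \<partial>\<kappa> x) \<partial>\<mu>)"
      unfolding fub[OF m dis(1)] fub[OF ms dis(2)] .
    then have "(\<lambda>k. (\<integral>x. d j l x * (\<integral>\<xi>. \<phi> j \<xi> \<partial>\<kappa>s k x) \<partial>\<mu>) - (\<integral>x. d j l x * (\<integral>\<xi>. \<phi> j \<xi> \<partial>\<kappa> x) \<partial>\<mu>)) \<longlonglongrightarrow> 0"
      by (simp add: LIM_zero)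
    then show ?thesis
      unfolding r_def by (subst d_def) (simp add: right_diff_distrib int)
  qed
  moreover have "\<bar>r j l k\<bar> \<le> (2 * B j) * (2 * B j)" for j l k
    unfolding r_def by (rule prob_space_abs_integral_le[OF \<mu>_prob _ prod_le]) measurable
  ultimately have "\<exists>(\<sigma> :: nat \<Rightarrow> nat) c. strict_mono \<sigma> \<and> (\<forall>j n. (\<Sum>l<n. \<bar>r j (\<sigma> l) (\<sigma> n)\<bar>) \<le> c j)"
    by (rule decorrelated_subsequence[where r=r and C="\<lambda>j. 2 * B j * (2 * B j)"]) blast
  then obtain \<sigma> :: "nat \<Rightarrow> nat" and c where \<sigma>: "strict_mono \<sigma>"
    and corr: "\<And>j n. (\<Sum>l<n. \<bar>r j (\<sigma> l) (\<sigma> n)\<bar>) \<le> c j"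
    by blast
  have "AE x in \<mu>. (\<lambda>n. (\<Sum>i<n\<^sup>2. d j (\<sigma> i) x) / real (n\<^sup>2)) \<longlonglongrightarrow> 0" for j
  proof (rule Banach_Saks_AE_squares[OF \<mu>_prob])
    show "(\<Sum>l<n. \<bar>\<integral>x. d j (\<sigma> l) x * d j (\<sigma> n) x \<partial>\<mu>\<bar>) \<le> c j" for n
      using corr[of j n] by (simp add: r_def)
  qed (use d_le in auto)
  then have "AE x in \<mu>. \<forall>j. (\<lambda>n. (\<Sum>i<n\<^sup>2. d j (\<sigma> i) x) / real (n\<^sup>2)) \<longlonglongrightarrow> 0"
    by (simp add: AE_all_countable)
  then obtain M where M: "M \<in> sets borel" "emeasure \<mu> M = 1"
    and M_lim: "\<And>x j. x \<in> M \<Longrightarrow> (\<lambda>n. (\<Sum>i<n\<^sup>2. d j (\<sigma> i) x) / real (n\<^sup>2)) \<longlonglongrightarrow> 0"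
  proof (rule AE_E)
    fix N assume N: "{x \<in> space \<mu>. \<not> (\<forall>j. (\<lambda>n. (\<Sum>i<n\<^sup>2. d j (\<sigma> i) x) / real (n\<^sup>2)) \<longlonglongrightarrow> 0)} \<subseteq> N"
      "emeasure \<mu> N = 0" "N \<in> sets \<mu>"
    have sp: "space \<mu> = UNIV"
      using sets_eq_imp_space_eq[OF \<mu>_sets] by simp
    have "emeasure \<mu> (space \<mu> - N) = 1"
      using N by (subst emeasure_compl) (auto simp: \<mu>.emeasure_space_1)
    then show thesis
      using N by (intro that[of "space \<mu> - N"]) (auto simp: sp \<mu>_sets)
  qed
  have "(\<lambda>n. (\<Sum>i<n\<^sup>2. \<integral>\<xi>. \<psi> \<xi> \<partial>\<kappa>s (\<sigma> i) x) / real (n\<^sup>2)) \<longlonglongrightarrow> (\<integral>\<xi>. \<psi> \<xi> \<partial>\<kappa> x)"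
    if "x \<in> M" and \<psi>: "continuous_on UNIV \<psi>" for x \<psi>
  proof (rule LIMSEQ_I)
    fix e :: real assume e: "0 < e"
    \<comment> \<open>Three errors of at most \<open>e / 4\<close> arise: replacing
      \<open>\<psi>\<close> by \<open>\<phi> j\<close> in the averages, the averaged deviations of
      \<open>\<phi> j\<close>, and replacing \<open>\<phi> j\<close> by \<open>\<psi>\<close> under
      \<open>\<kappa> x\<close>.\<close>
    then obtain j where j: "\<And>\<xi>. \<bar>\<psi> \<xi> - \<phi> j \<xi>\<bar> < e / 4"
      using \<phi>_dense[OF \<psi>, of "e/4"] by auto
    have [measurable]: "\<psi> \<in> borel_measurable borel"
      using \<psi> by (rule borel_measurable_continuous_onI)
    obtain b where b: "\<And>\<xi>. \<bar>\<psi> \<xi>\<bar> \<le> b"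
      using bounded_continuous_on_compact[OF E \<psi>] by blast
    have close: "\<bar>(\<integral>\<xi>. \<psi> \<xi> \<partial>\<nu>) - (\<integral>\<xi>. \<phi> j \<xi> \<partial>\<nu>)\<bar> \<le> e / 4"
      if "prob_space \<nu>" and [measurable_cong]: "sets \<nu> = sets borel" for \<nu> :: "'e measure"
    proof -
      interpret \<nu>: prob_space \<nu> by fact
      have "integrable \<nu> \<psi>"
        by (rule \<nu>.integrable_const_bound[where B=b]) (use b in auto)
      moreover have "integrable \<nu> (\<phi> j)"
        by (rule \<nu>.integrable_const_bound[where B="B j"]) (use B in auto)
      ultimately have "(\<integral>\<xi>. \<psi> \<xi> \<partial>\<nu>) - (\<integral>\<xi>. \<phi> j \<xi> \<partial>\<nu>) = (\<integral>\<xi>. \<psi> \<xi> - \<phi> j \<xi> \<partial>\<nu>)"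
        by simp
      then show ?thesis
        using prob_space_abs_integral_le[OF that(1), of "\<lambda>\<xi>. \<psi> \<xi> - \<phi> j \<xi>" "e/4"] j
        by (simp add: less_imp_le)
    qed
    obtain N where N: "\<And>n. n \<ge> N \<Longrightarrow> \<bar>(\<Sum>i<n\<^sup>2. d j (\<sigma> i) x) / real (n\<^sup>2)\<bar> < e / 4"
      using LIMSEQ_D[OF M_lim[OF \<open>x \<in> M\<close>, of j], of "e/4"] e by auto
    have "norm ((\<Sum>i<n\<^sup>2. \<integral>\<xi>. \<psi> \<xi> \<partial>\<kappa>s (\<sigma> i) x) / real (n\<^sup>2) - (\<integral>\<xi>. \<psi> \<xi> \<partial>\<kappa> x)) < e"
      if n: "n \<ge> max 1 N" for n
    proof -
      define A where "A = (\<Sum>i<n\<^sup>2. (\<integral>\<xi>. \<psi> \<xi> \<partial>\<kappa>s (\<sigma> i) x) - (\<integral>\<xi>. \<phi> j \<xi> \<partial>\<kappa>s (\<sigma> i) x))"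
      have "\<bar>A\<bar> \<le> real (n\<^sup>2) * (e / 4)"
        unfolding A_def
        using sum_norm_bound[of "{..<n\<^sup>2}" "\<lambda>i. (\<integral>\<xi>. \<psi> \<xi> \<partial>\<kappa>s (\<sigma> i) x) - (\<integral>\<xi>. \<phi> j \<xi> \<partial>\<kappa>s (\<sigma> i) x)" "e/4"]
          close[OF disintegration_kernel(2,1)[OF dis(2)]] by simp
      then have A: "\<bar>A / real (n\<^sup>2)\<bar> \<le> e / 4"
        using n by (simp add: field_simps)
      have "(\<Sum>i<n\<^sup>2. \<integral>\<xi>. \<psi> \<xi> \<partial>\<kappa>s (\<sigma> i) x)
          = A + (\<Sum>i<n\<^sup>2. d j (\<sigma> i) x) + real (n\<^sup>2) * (\<integral>\<xi>. \<phi> j \<xi> \<partial>\<kappa> x)"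
        unfolding A_def d_def by (simp add: sum_subtractf)
      then have "(\<Sum>i<n\<^sup>2. \<integral>\<xi>. \<psi> \<xi> \<partial>\<kappa>s (\<sigma> i) x) / real (n\<^sup>2)
          = A / real (n\<^sup>2) + (\<Sum>i<n\<^sup>2. d j (\<sigma> i) x) / real (n\<^sup>2) + (\<integral>\<xi>. \<phi> j \<xi> \<partial>\<kappa> x)"
        using n by (simp add: add_divide_distrib)
      then show ?thesis
        using A N[of n] n close[OF disintegration_kernel(2,1)[OF dis(1)], of x] e
        unfolding real_norm_def by linarith
    qed
    then show "\<exists>N. \<forall>n\<ge>N. norm ((\<Sum>i<n\<^sup>2. \<integral>\<xi>. \<psi> \<xi> \<partial>\<kappa>s (\<sigma> i) x) / real (n\<^sup>2) - (\<integral>\<xi>. \<psi> \<xi> \<partial>\<kappa> x)) < e"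
      by blast
  qed
  then show ?thesis
    using that[OF \<sigma> M] by blast
qed

section \<open>Uniform convergence and invariance of the limit\<close>

text \<open>A tube argument: joint continuity gives a product neighbourhood of \<open>(x, F)\<close>
  for every \<open>x\<close>, finitely many of them cover the compact base, and \<open>Fs k\<close>
  eventually lies in all their second factors. Both \<open>g x (Fs k)\<close> and
  \<open>g x F\<close> are then within \<open>e / 2\<close> of the value at the centre.\<close>

lemma eventually_uniformly_close:
  fixes g :: "'m::metric_space \<Rightarrow> 'c \<Rightarrow> 'b::metric_space"
  assumes "compact (UNIV :: 'm set)"
    and cont: "continuous_map (prod_topology euclidean T) euclidean (\<lambda>(x, F). g x F)"
    and lim: "limitin T Fs F sequentially" and e: "0 < e"
  shows "\<forall>\<^sub>F k in sequentially. \<forall>x. dist (g x (Fs k)) (g x F) < e"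
proof -
  have F: "F \<in> topspace T"
    using lim by (rule limitin_topspace)
  have "\<exists>U V. open U \<and> x \<in> U \<and> openin T V \<and> F \<in> V \<and> (\<forall>x'\<in>U. \<forall>F'\<in>V. dist (g x' F') (g x F) < e / 2)" for x
  proof -
    let ?S = "{z \<in> topspace (prod_topology euclidean T). (case z of (x, F) \<Rightarrow> g x F) \<in> ball (g x F) (e / 2)}"
    have "openin (prod_topology euclidean T) ?S"
      by (rule openin_continuous_map_preimage[OF cont]) simp
    moreover have "(x, F) \<in> ?S"
      using F e by simp
    ultimately obtain U V where "openin euclidean U" "openin T V" "x \<in> U" "F \<in> V" and UV: "U \<times> V \<subseteq> ?S"
      unfolding openin_prod_topology_alt by meson
    moreover have "dist (g x' F') (g x F) < e / 2" if "x' \<in> U" "F' \<in> V" for x' F'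
      using subsetD[OF UV, of "(x', F')"] that by (simp add: dist_commute)
    ultimately show ?thesis by (metis open_openin)
  qed
  then obtain U V where U: "\<And>x. open (U x)" "\<And>x. x \<in> U x" and V: "\<And>x. openin T (V x)" "\<And>x. F \<in> V x"
    and UV: "\<And>x x' F'. x' \<in> U x \<Longrightarrow> F' \<in> V x \<Longrightarrow> dist (g x' F') (g x F) < e / 2"
    by metis
  have "UNIV \<subseteq> (\<Union>x\<in>UNIV. U x)"
    using U(2) by blast
  then obtain I where I: "finite I" "UNIV \<subseteq> (\<Union>x\<in>I. U x)"
    by (rule compactE_image[OF assms(1) U(1)])
  have "\<forall>\<^sub>F k in sequentially. Fs k \<in> V x" for x
    using lim V unfolding limitin_def by blast
  then have "\<forall>\<^sub>F k in sequentially. \<forall>x\<in>I. Fs k \<in> V x"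
    using I(1) by (intro eventually_ball_finite) auto
  then show ?thesis
  proof eventually_elim
    case (elim k)
    show ?case
    proof
      fix x
      obtain y where y: "y \<in> I" "x \<in> U y"
        using subsetD[OF I(2) UNIV_I[of x]] by auto
      have "dist (g x (Fs k)) (g y F) < e / 2" "dist (g x F) (g y F) < e / 2"
        using UV[OF y(2)] V elim y(1) by auto
      then show "dist (g x (Fs k)) (g x F) < e"
        by (metis dist_commute dist_triangle_half_r)
    qed
  qed
qed

text \<open>By invariance of \<open>ms k\<close>, the integrals of \<open>\<phi> \<circ> F\<close>
  and \<open>\<phi>\<close> against \<open>ms k\<close> differ by the integral of
  \<open>\<phi> \<circ> F - \<phi> \<circ> Fs k\<close>. This integrand is uniformly small because
  \<open>\<phi>\<close> is uniformly continuous. Continuity of \<open>F\<close> makes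
  \<open>\<phi> \<circ> F\<close> an admissible test function for the weak* limit.\<close>

lemma invariant_measure_weak_star_limit:
  fixes F :: "'a::metric_space \<Rightarrow> 'a"
  assumes "compact (UNIV :: 'a set)" and F: "continuous_on UNIV F"
    and unif: "\<And>e. 0 < e \<Longrightarrow> \<forall>\<^sub>F k in sequentially. \<forall>z. dist (Fs k z) (F z) < e"
    and m: "borel_probability m" and ms: "\<And>k. borel_probability (ms k)"
    and inv: "\<And>k. invariant_measure (Fs k) (ms k)" and weak: "weak_star_tendsto ms m"
  shows "invariant_measure F m"
proof -
  have sets[measurable_cong]: "sets m = sets borel" "\<And>k. sets (ms k) = sets borel"
    and prob: "prob_space m" "\<And>k. prob_space (ms k)"
    using m ms by (auto simp: borel_probability_def)
  have F_meas[measurable]: "F \<in> borel_measurable borel"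
    using F by (rule borel_measurable_continuous_onI)
  have Fs_meas[measurable]: "Fs k \<in> borel_measurable borel" and Fs_inv: "distr (ms k) borel (Fs k) = ms k" for k
    using inv by (auto simp: invariant_measure_def)
  have "distr m borel F = m"
  proof (rule finite_measure_eqI_continuous)
    have "F \<in> borel_measurable m" by measurable
    from prob_space.prob_space_distr[OF prob(1) this]
    show "finite_measure (distr m borel F)" "finite_measure m"
      using prob(1) by (auto simp: prob_space_def)
    fix \<phi> :: "'a \<Rightarrow> real" assume \<phi>: "continuous_on UNIV \<phi>" "bounded (range \<phi>)"
    have [measurable]: "\<phi> \<in> borel_measurable borel"
      using \<phi>(1) by (rule borel_measurable_continuous_onI)
    obtain b where b: "\<And>z. \<bar>\<phi> z\<bar> \<le> b"
      using \<phi>(2) by (auto simp: bounded_iff)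
    have lim: "(\<lambda>k. \<integral>z. \<phi> z \<partial>ms k) \<longlonglongrightarrow> (\<integral>z. \<phi> z \<partial>m)"
      using weak \<phi> unfolding weak_star_tendsto_def by blast
    have "continuous_on UNIV (\<lambda>z. \<phi> (F z))" "bounded (range (\<lambda>z. \<phi> (F z)))"
      using continuous_on_compose2[OF \<phi>(1) F] b by (auto simp: bounded_iff)
    then have limF: "(\<lambda>k. \<integral>z. \<phi> (F z) \<partial>ms k) \<longlonglongrightarrow> (\<integral>z. \<phi> (F z) \<partial>m)"
      using weak unfolding weak_star_tendsto_def by blast
    have "(\<lambda>k. (\<integral>z. \<phi> (F z) \<partial>ms k) - (\<integral>z. \<phi> z \<partial>ms k)) \<longlonglongrightarrow> 0"
    proof (rule tendstoI)
      fix e :: real assume e: "0 < e"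
      have "uniformly_continuous_on UNIV \<phi>"
        using \<phi>(1) assms(1) by (rule compact_uniformly_continuous)
      moreover have "0 < e / 2" using e by simp
      ultimately obtain \<delta> where \<delta>: "0 < \<delta>" "\<And>z w. dist z w < \<delta> \<Longrightarrow> \<bar>\<phi> z - \<phi> w\<bar> < e / 2"
        unfolding uniformly_continuous_on_def dist_real_def by (metis UNIV_I)
      show "\<forall>\<^sub>F k in sequentially. dist ((\<integral>z. \<phi> (F z) \<partial>ms k) - (\<integral>z. \<phi> z \<partial>ms k)) 0 < e"
        using unif[OF \<delta>(1)]
      proof eventually_elim
        case (elim k)
        interpret k: prob_space "ms k" by (rule prob)
        have "(\<integral>z. \<phi> z \<partial>ms k) = (\<integral>z. \<phi> (Fs k z) \<partial>ms k)"
          using integral_distr[of "Fs k" "ms k" borel \<phi>] by (simp add: Fs_inv)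
        moreover have "integrable (ms k) (\<lambda>z. \<phi> (F z))"
          by (rule k.integrable_const_bound[where B=b]) (use b in auto)
        moreover have "integrable (ms k) (\<lambda>z. \<phi> (Fs k z))"
          by (rule k.integrable_const_bound[where B=b]) (use b in auto)
        ultimately have "(\<integral>z. \<phi> (F z) \<partial>ms k) - (\<integral>z. \<phi> z \<partial>ms k) = (\<integral>z. \<phi> (F z) - \<phi> (Fs k z) \<partial>ms k)"
          by simp
        moreover have "\<bar>\<integral>z. \<phi> (F z) - \<phi> (Fs k z) \<partial>ms k\<bar> \<le> e / 2"
        proof (rule prob_space_abs_integral_le[OF prob(2)])
          show "\<bar>\<phi> (F z) - \<phi> (Fs k z)\<bar> \<le> e / 2" for z
            using \<delta>(2)[of "F z" "Fs k z"] elim by (simp add: dist_commute less_imp_le)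
        qed measurable
        ultimately show ?case using e by simp
      qed
    qed
    moreover have "(\<lambda>k. (\<integral>z. \<phi> (F z) \<partial>ms k) - (\<integral>z. \<phi> z \<partial>ms k)) \<longlonglongrightarrow> (\<integral>z. \<phi> (F z) \<partial>m) - (\<integral>z. \<phi> z \<partial>m)"
      by (intro tendsto_diff limF lim)
    ultimately have "(\<integral>z. \<phi> (F z) \<partial>m) = (\<integral>z. \<phi> z \<partial>m)"
      using LIMSEQ_unique by fastforce
    then show "integral\<^sup>L (distr m borel F) \<phi> = integral\<^sup>L m \<phi>"
      by (simp add: integral_distr)
  qed (use sets in auto)
  then show ?thesis
    by (simp add: invariant_measure_def)
qed

section \<open>Supremum distance and skew products\<close>

text \<open>\<open>Bcontfun\<close> is invertible only on bounded continuous maps; on a compact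
  space continuity already gives boundedness.\<close>

lemma apply_Bcontfun_compact:
  fixes h :: "'e::metric_space \<Rightarrow> 'e"
  assumes "compact (UNIV :: 'e set)" "continuous_on UNIV h"
  shows "apply_bcontfun (Bcontfun h) = h"
  using assms compact_imp_bounded[OF compact_continuous_image[OF assms(2,1)]]
  by (intro Bcontfun_inverse) (simp add: bcontfun_def)

lemma dist_le_Bcontfun_compact:
  fixes h h' :: "'e::metric_space \<Rightarrow> 'e"
  assumes "compact (UNIV :: 'e set)" "continuous_on UNIV h" "continuous_on UNIV h'"
  shows "dist (h \<xi>) (h' \<xi>) \<le> dist (Bcontfun h) (Bcontfun h')"
  using dist_bounded[of "Bcontfun h" \<xi> "Bcontfun h'"] assms by (simp add: apply_Bcontfun_compact)

text \<open>Joint continuity follows by changing the base point first, at a cost bounded by the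
  supremum distance uniformly in the fibre coordinate, and then moving inside one fixed
  fibre.\<close>

lemma continuous_on_skew_product:
  fixes F :: "'m::metric_space \<times> 'e::metric_space \<Rightarrow> 'm \<times> 'e"
  assumes E: "compact (UNIV :: 'e set)" and base: "fst \<circ> F = f \<circ> fst" and f: "continuous_on UNIV f"
    and fib: "\<And>x. continuous_on UNIV (fibre_map F x)"
    and cont: "continuous_on UNIV (\<lambda>x. Bcontfun (fibre_map F x))"
  shows "continuous_on UNIV F"
proof -
  have "continuous_on UNIV (\<lambda>z. fibre_map F (fst z) (snd z))"
    unfolding continuous_on_def
  proof safe
    fix x :: 'm and \<xi> :: 'e
    have "((\<lambda>z. Bcontfun (fibre_map F (fst z))) \<longlongrightarrow> Bcontfun (fibre_map F x)) (at (x, \<xi>))"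
      using continuous_on_compose2[OF cont continuous_on_fst[OF continuous_on_id], of UNIV]
      by (auto simp: continuous_on_def)
    then have 1: "((\<lambda>z. dist (Bcontfun (fibre_map F (fst z))) (Bcontfun (fibre_map F x))) \<longlongrightarrow> 0) (at (x, \<xi>))"
      by (subst (asm) tendsto_dist_iff)
    have "((\<lambda>z. fibre_map F x (snd z)) \<longlongrightarrow> fibre_map F x \<xi>) (at (x, \<xi>))"
      using continuous_on_compose2[OF fib[of x] continuous_on_snd[OF continuous_on_id], of UNIV]
      by (auto simp: continuous_on_def)
    then have 2: "((\<lambda>z. dist (fibre_map F x (snd z)) (fibre_map F x \<xi>)) \<longlongrightarrow> 0) (at (x, \<xi>))"
      by (subst (asm) tendsto_dist_iff)
    have "((\<lambda>z. dist (fibre_map F (fst z) (snd z)) (fibre_map F x \<xi>)) \<longlongrightarrow> 0) (at (x, \<xi>))"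
    proof (rule tendsto_sandwich[OF _ _ tendsto_const tendsto_add[OF 1 2, unfolded add_0]])
      have "dist (fibre_map F (fst z) (snd z)) (fibre_map F x \<xi>)
        \<le> dist (Bcontfun (fibre_map F (fst z))) (Bcontfun (fibre_map F x)) + dist (fibre_map F x (snd z)) (fibre_map F x \<xi>)" for z
        using dist_triangle[of "fibre_map F (fst z) (snd z)" "fibre_map F x \<xi>" "fibre_map F x (snd z)"]
          dist_le_Bcontfun_compact[OF E fib fib, of "fst z" "snd z" x] by linarith
      then show "\<forall>\<^sub>F z in at (x, \<xi>). dist (fibre_map F (fst z) (snd z)) (fibre_map F x \<xi>)
        \<le> dist (Bcontfun (fibre_map F (fst z))) (Bcontfun (fibre_map F x)) + dist (fibre_map F x (snd z)) (fibre_map F x \<xi>)"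
        by (rule always_eventually[OF allI])
    qed simp
    then show "((\<lambda>z. fibre_map F (fst z) (snd z)) \<longlongrightarrow> fibre_map F (fst (x, \<xi>)) (snd (x, \<xi>))) (at (x, \<xi>))"
      unfolding fst_conv snd_conv by (subst tendsto_dist_iff)
  qed
  moreover have "continuous_on UNIV (\<lambda>z::'m \<times> 'e. f (fst z))"
    by (rule continuous_on_compose2[OF f]) (auto intro: continuous_intros)
  ultimately have "continuous_on UNIV (\<lambda>z. (f (fst z), fibre_map F (fst z) (snd z)))"
    by (intro continuous_on_Pair)
  also have "(\<lambda>z. (f (fst z), fibre_map F (fst z) (snd z))) = F"
    using base by (auto simp: fibre_map_def fun_eq_iff prod_eq_iff)
  finally show ?thesis .
qed

lemma stable_holonomy_continuous:
  assumes "stable_holonomies W f F H" "same_leaf W x y"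
  shows "continuous_on UNIV (H x y)"
proof -
  have "continuous_on {(x, y, \<xi>). same_leaf W x y} (\<lambda>(x, y, \<xi>). H x y \<xi>)"
    using assms(1) by (simp add: stable_holonomies_def)
  then have "continuous_on UNIV (\<lambda>\<xi>. (\<lambda>(x, y, \<xi>). H x y \<xi>) (x, y, \<xi>))"
    by (rule continuous_on_compose2) (use assms(2) in \<open>auto intro!: continuous_intros\<close>)
  then show ?thesis by simp
qed

section \<open>Passing the holonomy relation to the limit\<close>

theorem theorem3p1:
  fixes A :: "('m::{metric_space, second_countable_topology}, 'n::euclidean_space) chart set"
    and B :: "('e::{metric_space, second_countable_topology}, 'k::euclidean_space) chart set"
    and l :: real and r :: nat
    and f :: "'m \<Rightarrow> 'm"
    and Es Ec Eu :: "'m \<Rightarrow> 'n set"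
    and W :: "'m set set"
    and \<mu> :: "'m measure"
    and T :: "('m \<times> 'e \<Rightarrow> 'm \<times> 'e) topology"
    and Hol :: "('m \<times> 'e \<Rightarrow> 'm \<times> 'e) \<Rightarrow> 'm \<Rightarrow> 'm \<Rightarrow> 'e \<Rightarrow> 'e"
    and Fs :: "nat \<Rightarrow> 'm \<times> 'e \<Rightarrow> 'm \<times> 'e"
    and F :: "'m \<times> 'e \<Rightarrow> 'm \<times> 'e"
    and ms :: "nat \<Rightarrow> ('m \<times> 'e) measure"
    and m :: "('m \<times> 'e) measure"
  assumes "1 < l" and "compact_manifold l A"
    and "1 \<le> r" and "compact_manifold (real r) B"
    and "partially_hyperbolic A f Es Ec Eu"
    and "strong_stable_foliation A f Es W"
    and "borel_probability \<mu>" and "invariant_measure f \<mu>"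
    and "cocycle_topology r B f W T Hol"
    and "\<And>k. Fs k \<in> topspace T" and "F \<in> topspace T"
    and "\<And>k. s_state W \<mu> (Fs k) (Hol (Fs k)) (ms k)"
    and "borel_probability m"
    and "limitin T Fs F sequentially"
    and "weak_star_tendsto ms m"
  shows "s_state W \<mu> F (Hol F) m"
proof -
  have compM: "compact (UNIV :: 'm set)" and compE: "compact (UNIV :: 'e set)"
    using assms(2,4) by (auto simp: compact_manifold_def)
  have compME: "compact (UNIV :: ('m \<times> 'e) set)"
    using compact_Times[OF compM compE] by simp
  have f_cont: "continuous_on UNIV f"
    using assms(5) by (simp add: partially_hyperbolic_def diffeo_def Ck_map_def)
  have coc: "cocycle r B f G" and hol: "stable_holonomies W f G (Hol G)" if "G \<in> topspace T" for G
    using assms(9) that by (auto simp: cocycle_topology_def)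
  have fib: "continuous_on UNIV (fibre_map G x)" if "G \<in> topspace T" for G x
    using coc[OF that] by (simp add: cocycle_def diffeo_def Ck_map_def)
  have base: "G (x, \<xi>) = (f x, fibre_map G x \<xi>)" if "G \<in> topspace T" for G x \<xi>
  proof -
    have "(fst \<circ> G) (x, \<xi>) = (f \<circ> fst) (x, \<xi>)"
      using coc[OF that] by (simp add: cocycle_def)
    then show ?thesis by (simp add: fibre_map_def prod_eq_iff)
  qed
  have fib_jcont: "continuous_map (prod_topology euclidean T) euclidean (\<lambda>(x, G). Bcontfun (fibre_map G x))"
    using assms(9) by (simp add: cocycle_topology_def)
  have F_cont: "continuous_on UNIV F"
  proof (rule continuous_on_skew_product[OF compE _ f_cont fib[OF assms(11)]])
    show "fst \<circ> F = f \<circ> fst"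
      using coc[OF assms(11)] by (simp add: cocycle_def)
    have "continuous_map euclidean (prod_topology euclidean T) (\<lambda>x. (x, F))"
      using assms(11) by (simp add: continuous_map_pairwise o_def)
    from continuous_map_compose[OF this fib_jcont]
    show "continuous_on UNIV (\<lambda>x. Bcontfun (fibre_map F x))"
      by (simp add: o_def)
  qed
  have prob: "borel_probability (ms k)" "invariant_measure (Fs k) (ms k)" "projects_to (ms k) \<mu>" for k
    using assms(12)[of k] by (auto simp: s_state_def)
  have proj: "projects_to m \<mu>"
    by (rule projects_to_weak_star_limit[OF assms(7,13) prob(1,3) assms(15)])
  have inv: "invariant_measure F m"
  proof (rule invariant_measure_weak_star_limit[OF compME F_cont _ assms(13) prob(1,2) assms(15)])
    fix e :: real assume "0 < e"
    from eventually_uniformly_close[OF compM fib_jcont assms(14) this]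
    show "\<forall>\<^sub>F k in sequentially. \<forall>z. dist (Fs k z) (F z) < e"
    proof eventually_elim
      case (elim k)
      \<comment> \<open>Both images lie over \<open>f x\<close>, so their distance is that of the
        fibre coordinates, which the supremum distance of the fibre maps bounds.\<close>
      have "dist (Fs k (x, \<xi>)) (F (x, \<xi>)) < e" for x \<xi>
        using elim[rule_format, of x]
          dist_le_Bcontfun_compact[OF compE fib[OF assms(10)] fib[OF assms(11)], of k x \<xi> x]
        by (simp add: base assms(10,11) dist_Pair_Pair)
      then show ?case by auto
    qed
  qed
  have "\<exists>\<kappa> M. disintegration \<mu> (ms k) \<kappa> \<and> M \<in> sets borel \<and> emeasure \<mu> M = 1 \<and>
      (\<forall>x\<in>M. \<forall>y\<in>M. same_leaf W x y \<longrightarrow> distr (\<kappa> x) borel (Hol (Fs k) x y) = \<kappa> y)" for k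
    using assms(12)[of k] unfolding s_state_def by blast
  then obtain \<kappa>s Ms where dis_s: "\<And>k. disintegration \<mu> (ms k) (\<kappa>s k)"
    and Ms: "\<And>k. Ms k \<in> sets borel" "\<And>k. emeasure \<mu> (Ms k) = 1"
    and Ms_hol: "\<And>k x y. x \<in> Ms k \<Longrightarrow> y \<in> Ms k \<Longrightarrow> same_leaf W x y \<Longrightarrow>
      distr (\<kappa>s k x) borel (Hol (Fs k) x y) = \<kappa>s k y"
    by metis
  \<comment> \<open>For each \<open>ms k\<close> a disintegration is part of being an s-state; for
    the limit \<open>m\<close> one has to be constructed.\<close>
  obtain \<kappa> where dis: "disintegration \<mu> m \<kappa>"
    by (rule Rokhlin_disintegration[OF compE assms(7,13) proj])
  obtain \<sigma> :: "nat \<Rightarrow> nat" and M where \<sigma>: "strict_mono \<sigma>" and M: "M \<in> sets borel" "emeasure \<mu> M = 1"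
    and avg: "\<And>x \<phi>. x \<in> M \<Longrightarrow> continuous_on UNIV \<phi> \<Longrightarrow>
      (\<lambda>n. (\<Sum>i<n\<^sup>2. \<integral>\<xi>. \<phi> \<xi> \<partial>\<kappa>s (\<sigma> i) x) / real (n\<^sup>2)) \<longlonglongrightarrow> (\<integral>\<xi>. \<phi> \<xi> \<partial>\<kappa> x)"
    by (rule disintegrations_average_converge[OF compE assms(7,13) prob(1) proj prob(3) assms(15) dis dis_s]) blast
  \<comment> \<open>The full-measure set on which the holonomy relation holds depends on
    \<open>k\<close>; a countable intersection keeps full measure.\<close>
  define M' where "M' = M \<inter> (\<Inter>k. Ms k)"
  have M'_sets: "M' \<in> sets borel"
    unfolding M'_def using M(1) Ms(1) by auto
  interpret \<mu>: prob_space \<mu>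
    using assms(7) by (simp add: borel_probability_def)
  have \<mu>_sets: "sets \<mu> = sets borel"
    using assms(7) by (simp add: borel_probability_def)
  have full: "emeasure \<mu> S = 1 \<longleftrightarrow> (AE x in \<mu>. x \<in> S)" if "S \<in> sets borel" for S
    using \<mu>.AE_in_set_eq_1[of S] that by (simp add: \<mu>_sets \<mu>.emeasure_eq_measure)
  have "AE x in \<mu>. x \<in> M \<and> (\<forall>k. x \<in> Ms k)"
    using M Ms by (simp add: full AE_all_countable)
  then have M'_full: "emeasure \<mu> M' = 1"
    unfolding full[OF M'_sets] by (simp add: M'_def)
  have "distr (\<kappa> x) borel (Hol F x y) = \<kappa> y" if x: "x \<in> M'" and y: "y \<in> M'" and leaf: "same_leaf W x y" for x y
  proof (rule finite_measure_eqI_continuous)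
    have H_cont: "continuous_on UNIV (Hol G x y)" if "G \<in> topspace T" for G
      by (rule stable_holonomy_continuous[OF hol[OF that] leaf])
    have H_meas: "Hol G x y \<in> borel_measurable (\<kappa>' z)"
      if "G \<in> topspace T" "disintegration \<mu> m' \<kappa>'" for G m' z and \<kappa>' :: "'m \<Rightarrow> 'e measure"
      using borel_measurable_continuous_onI[OF H_cont[OF that(1)]]
      by (simp add: measurable_cong_sets[OF disintegration_kernel(1)[OF that(2)] refl])
    show "finite_measure (distr (\<kappa> x) borel (Hol F x y))"
      using prob_space.prob_space_distr[OF disintegration_kernel(2)[OF dis] H_meas[OF assms(11) dis]]
      by (simp add: prob_space_def)
    show "finite_measure (\<kappa> y)"
      using disintegration_kernel(2)[OF dis] by (simp add: prob_space_def)
    show "sets (distr (\<kappa> x) borel (Hol F x y)) = sets borel" "sets (\<kappa> y) = sets borel"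
      by (simp_all add: disintegration_kernel[OF dis])
    fix \<phi> :: "'e \<Rightarrow> real" assume \<phi>: "continuous_on UNIV \<phi>" "bounded (range \<phi>)"
    then have \<phi>_meas: "\<phi> \<in> borel_measurable borel"
      by (intro borel_measurable_continuous_onI)
    obtain b where b: "\<And>\<xi>. \<bar>\<phi> \<xi>\<bar> \<le> b"
      using \<phi>(2) by (auto simp: bounded_iff)
    \<comment> \<open>The first integral already uses the holonomy of the limit \<open>F\<close>.
      Hence \<open>\<phi> \<circ> Hol F x y\<close> is one fixed continuous test function to which
      \<open>avg\<close> applies at \<open>x\<close>, while \<open>\<phi>\<close> itself is used at
      \<open>y\<close>.\<close>
    define a where "a i = (\<integral>\<xi>. \<phi> (Hol F x y \<xi>) \<partial>\<kappa>s (\<sigma> i) x) - (\<integral>\<xi>. \<phi> \<xi> \<partial>\<kappa>s (\<sigma> i) y)" for i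
    \<comment> \<open>Only the cocycle varies here: the pair \<open>x\<close>, \<open>y\<close> is
      fixed, so the sequence stays in the set of same-leaf pairs on which continuity is
      assumed.\<close>
    have H_lim: "(\<lambda>k. Bcontfun (Hol (Fs k) x y)) \<longlonglongrightarrow> Bcontfun (Hol F x y)"
    proof -
      have "limitin (subtopology (prod_topology euclidean (prod_topology euclidean T)) {(x, y, F). same_leaf W x y})
          (\<lambda>k. (x, y, Fs k)) (x, y, F) sequentially"
        using assms(14) leaf by (simp add: limitin_subtopology limitin_pairwise o_def)
      moreover have "continuous_map
          (subtopology (prod_topology euclidean (prod_topology euclidean T)) {(x, y, F). same_leaf W x y})
          euclidean (\<lambda>(x, y, F). Bcontfun (Hol F x y))"
        using assms(9) by (simp add: cocycle_topology_def)
      ultimately have "limitin euclidean ((\<lambda>(x, y, F). Bcontfun (Hol F x y)) \<circ> (\<lambda>k. (x, y, Fs k)))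
          (Bcontfun (Hol F x y)) sequentially"
        using continuous_map_limit by fastforce
      then show ?thesis by (simp add: o_def)
    qed
    have "a \<longlonglongrightarrow> 0"
    proof (rule tendstoI)
      fix e :: real assume e: "0 < e"
      have "uniformly_continuous_on UNIV \<phi>"
        using \<phi>(1) compE by (rule compact_uniformly_continuous)
      moreover have "0 < e / 2" using e by simp
      ultimately obtain \<delta> where \<delta>: "0 < \<delta>" "\<And>z w. dist z w < \<delta> \<Longrightarrow> \<bar>\<phi> z - \<phi> w\<bar> < e / 2"
        unfolding uniformly_continuous_on_def dist_real_def by (metis UNIV_I)
      have "(\<lambda>i. Bcontfun (Hol (Fs (\<sigma> i)) x y)) \<longlonglongrightarrow> Bcontfun (Hol F x y)"
        using LIMSEQ_subseq_LIMSEQ[OF H_lim \<sigma>] by (simp add: o_def)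
      from tendstoD[OF this \<delta>(1)]
      show "\<forall>\<^sub>F i in sequentially. dist (a i) 0 < e"
      proof eventually_elim
        case (elim i)
        let ?\<nu> = "\<kappa>s (\<sigma> i) x" and ?H = "Hol (Fs (\<sigma> i)) x y"
        interpret \<nu>: prob_space ?\<nu>
          by (rule disintegration_kernel(2)[OF dis_s])
        have H[measurable]: "?H \<in> borel_measurable ?\<nu>" "Hol F x y \<in> borel_measurable ?\<nu>"
          using H_meas[OF assms(10) dis_s] H_meas[OF assms(11) dis_s] by auto
        note \<phi>_meas[measurable]
        have "\<kappa>s (\<sigma> i) y = distr ?\<nu> borel ?H"
          using Ms_hol[OF _ _ leaf, of "\<sigma> i"] x y by (auto simp: M'_def)
        then have "(\<integral>\<xi>. \<phi> \<xi> \<partial>\<kappa>s (\<sigma> i) y) = (\<integral>\<xi>. \<phi> (?H \<xi>) \<partial>?\<nu>)"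
          by (simp add: integral_distr)
        moreover have "integrable ?\<nu> (\<lambda>\<xi>. \<phi> (Hol F x y \<xi>))"
          by (rule \<nu>.integrable_const_bound[where B=b]) (use b in auto)
        moreover have "integrable ?\<nu> (\<lambda>\<xi>. \<phi> (?H \<xi>))"
          by (rule \<nu>.integrable_const_bound[where B=b]) (use b in auto)
        ultimately have "a i = (\<integral>\<xi>. \<phi> (Hol F x y \<xi>) - \<phi> (?H \<xi>) \<partial>?\<nu>)"
          by (simp add: a_def)
        moreover have "\<bar>\<integral>\<xi>. \<phi> (Hol F x y \<xi>) - \<phi> (?H \<xi>) \<partial>?\<nu>\<bar> \<le> e / 2"
        proof (rule prob_space_abs_integral_le[OF \<nu>.prob_space_axioms])
          fix \<xi>
          have "dist (?H \<xi>) (Hol F x y \<xi>) < \<delta>"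
            using dist_le_Bcontfun_compact[OF compE H_cont[OF assms(10)] H_cont[OF assms(11)], of "\<sigma> i" \<xi>] elim
            by linarith
          then show "\<bar>\<phi> (Hol F x y \<xi>) - \<phi> (?H \<xi>)\<bar> \<le> e / 2"
            using \<delta>(2)[of "Hol F x y \<xi>" "?H \<xi>"] by (simp add: dist_commute less_imp_le)
        qed measurable
        ultimately show ?case using e by simp
      qed
    qed
    \<comment> \<open>The same averages have two limits, zero and the defect of the holonomy
      relation for \<open>\<kappa>\<close> tested on \<open>\<phi>\<close>; so the defect
      vanishes.\<close>
    then have "(\<lambda>n. (\<Sum>i<n\<^sup>2. a i) / real (n\<^sup>2)) \<longlonglongrightarrow> 0"
      by (rule Cesaro_squares_null)
    moreover have "(\<lambda>n. (\<Sum>i<n\<^sup>2. a i) / real (n\<^sup>2)) \<longlonglongrightarrow> (\<integral>\<xi>. \<phi> (Hol F x y \<xi>) \<partial>\<kappa> x) - (\<integral>\<xi>. \<phi> \<xi> \<partial>\<kappa> y)"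
    proof -
      have "continuous_on UNIV (\<lambda>\<xi>. \<phi> (Hol F x y \<xi>))"
        by (rule continuous_on_compose2[OF \<phi>(1) H_cont[OF assms(11)]]) simp
      then have "(\<lambda>n. (\<Sum>i<n\<^sup>2. \<integral>\<xi>. \<phi> (Hol F x y \<xi>) \<partial>\<kappa>s (\<sigma> i) x) / real (n\<^sup>2)
          - (\<Sum>i<n\<^sup>2. \<integral>\<xi>. \<phi> \<xi> \<partial>\<kappa>s (\<sigma> i) y) / real (n\<^sup>2))
        \<longlonglongrightarrow> (\<integral>\<xi>. \<phi> (Hol F x y \<xi>) \<partial>\<kappa> x) - (\<integral>\<xi>. \<phi> \<xi> \<partial>\<kappa> y)"
        using x y \<phi>(1) by (intro tendsto_diff avg) (auto simp: M'_def)
      then show ?thesis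
        by (simp add: a_def sum_subtractf diff_divide_distrib)
    qed
    ultimately have "(\<integral>\<xi>. \<phi> (Hol F x y \<xi>) \<partial>\<kappa> x) = (\<integral>\<xi>. \<phi> \<xi> \<partial>\<kappa> y)"
      using LIMSEQ_unique by fastforce
    then show "integral\<^sup>L (distr (\<kappa> x) borel (Hol F x y)) \<phi> = integral\<^sup>L (\<kappa> y) \<phi>"
      using H_meas[OF assms(11) dis] \<phi>_meas by (simp add: integral_distr)
  qed
  then show ?thesis
    unfolding s_state_def using assms(13) inv proj dis M'_sets M'_full by blast
qed

end
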